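(* Let $a\ge 3$ be an integer and let $\rho$ be the root with $\rho>1$ of the polynomial $x^3+(a-1)x^2-ax-1$. Then the elements $1$, \begin{align*} 1+s\rho+\rho^2 \;&\text{ where } 1\leq s\leq a-1,\\ -v-(a(v-1)+w)\rho+(a(v-1)+w+1)\rho^2 \;&\text{ where } 1\leq v \leq a-1 \text{ and } \max\{1,v-1\}\leq w\leq a-1,\\ -1-u\rho+(u+2)\rho^2 \;&\text{ where } 0\leq u\leq a-2 \end{align*} (with $s,v,w,u$ integers) are, up to multiplication by units of $\mathbb{Z}[\rho]$, all the $\mathfrak{s}$-indecomposable integers in $\mathbb{Z}[\rho]$, where $\mathfrak s$ runs over all signatures. That is, each listed element is indecomposable in its own signature, and every element of $\mathbb{Z}[\rho]$ that is $\mathfrak{s}$-indecomposable for some signature $\mathfrak{s}$ is the product of a listed element and a unit of $\mathbb{Z}[\rho]$.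
   Context: The polynomial $x^3+(a-1)x^2-ax-1$ has three real roots $\rho>1$, $-1<\rho'<0$, $\rho''<-1$, so $K=\mathbb{Q}(\rho)$ is a totally real cubic field, with embeddings $\sigma_1,\sigma_2,\sigma_3:K\to\mathbb{R}$ sending $\rho$ to $\rho,\rho',\rho''$ respectively. The signature of a nonzero $\alpha\in K$ is the triple of signs $(\mathrm{sgn}\,\sigma_1(\alpha),\mathrm{sgn}\,\sigma_2(\alpha),\mathrm{sgn}\,\sigma_3(\alpha))$. For a signature $\mathfrak{s}\in\{+,-\}^3$ and an order $\mathcal{O}\subset K$, let $\mathcal{O}^{\mathfrak{s}}$ be the set of elements of $\mathcal{O}$ with signature $\mathfrak{s}$. An element $\alpha\in\mathcal{O}^{\mathfrak{s}}$ is $\mathfrak{s}$-indecomposable in $\mathcal{O}$ if it cannot be written as $\alpha=\beta+\gamma$ with $\beta,\gamma\in\mathcal{O}^{\mathfrak{s}}$; here $\mathcal{O}=\mathbb{Z}[\rho]$. *)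

theory Defs
  imports Complex_Main "HOL-Computational_Algebra.Polynomial"
begin

definition cubic :: "int \<Rightarrow> real poly" where
  "cubic a = [:-1, - of_int a, of_int a - 1, 1:]"

definition int_adjoin :: "real \<Rightarrow> real set" where
  "int_adjoin \<rho> = {poly (map_poly of_int p) \<rho> | p :: int poly. True}"

definition rat_adjoin :: "real \<Rightarrow> real set" where
  "rat_adjoin \<rho> = {poly (map_poly of_rat p) \<rho> / poly (map_poly of_rat q) \<rho> | p q :: rat poly.
     poly (map_poly of_rat q) \<rho> \<noteq> 0}"

text \<open>Only the values of \<open>\<sigma>\<close> on the subfield \<open>K\<close> matter.\<close>

definition field_embedding :: "real set \<Rightarrow> (real \<Rightarrow> real) \<Rightarrow> bool" where
  "field_embedding K \<sigma> \<longleftrightarrow> \<sigma> 1 = 1 \<and>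
     (\<forall>x\<in>K. \<forall>y\<in>K. \<sigma> (x + y) = \<sigma> x + \<sigma> y \<and> \<sigma> (x * y) = \<sigma> x * \<sigma> y)"

definition units_of_order :: "real set \<Rightarrow> real set" where
  "units_of_order R = {u \<in> R. \<exists>v\<in>R. u * v = 1}"

text \<open>The signs \<open>+\<close> and \<open>-\<close> are represented by the reals \<open>1\<close> and \<open>-1\<close>.\<close>

definition signatures :: "(real \<times> real \<times> real) set" where
  "signatures = {1, -1} \<times> {1, -1} \<times> {1, -1}"

definition signature ::
  "(real \<Rightarrow> real) \<Rightarrow> (real \<Rightarrow> real) \<Rightarrow> (real \<Rightarrow> real) \<Rightarrow> real \<Rightarrow> real \<times> real \<times> real" where
  "signature \<sigma>\<^sub>1 \<sigma>\<^sub>2 \<sigma>\<^sub>3 \<alpha> = (sgn (\<sigma>\<^sub>1 \<alpha>), sgn (\<sigma>\<^sub>2 \<alpha>), sgn (\<sigma>\<^sub>3 \<alpha>))"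

text \<open>In the next two definitions \<open>sig\<close> is the signature map of the field.\<close>

definition signature_part ::
  "(real \<Rightarrow> real \<times> real \<times> real) \<Rightarrow> real set \<Rightarrow> real \<times> real \<times> real \<Rightarrow> real set" where
  "signature_part sig R s = {\<alpha> \<in> R. \<alpha> \<noteq> 0 \<and> sig \<alpha> = s}"

definition indecomposable ::
  "(real \<Rightarrow> real \<times> real \<times> real) \<Rightarrow> real set \<Rightarrow> real \<times> real \<times> real \<Rightarrow> real \<Rightarrow> bool" where
  "indecomposable sig R s \<alpha> \<longleftrightarrow> \<alpha> \<in> signature_part sig R s \<and>
     \<not> (\<exists>\<beta> \<in> signature_part sig R s. \<exists>\<gamma> \<in> signature_part sig R s. \<alpha> = \<beta> + \<gamma>)"

definition listed_elements :: "int \<Rightarrow> real \<Rightarrow> real set" where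
  "listed_elements a \<rho> =
     {1}
   \<union> {1 + of_int s * \<rho> + \<rho>\<^sup>2 | s :: int. 1 \<le> s \<and> s \<le> a - 1}
   \<union> {- of_int v - of_int (a * (v - 1) + w) * \<rho> + of_int (a * (v - 1) + w + 1) * \<rho>\<^sup>2 | v w :: int.
        1 \<le> v \<and> v \<le> a - 1 \<and> max 1 (v - 1) \<le> w \<and> w \<le> a - 1}
   \<union> {- 1 - of_int u * \<rho> + of_int (u + 2) * \<rho>\<^sup>2 | u :: int. 0 \<le> u \<and> u \<le> a - 2}"


text \<open>The three roots in the prescribed intervals are unique, and the three embeddings exist.\<close>

lemma cubic_eval: "poly (cubic a) x = x^3 + (of_int a - 1) * x^2 - of_int a * x - 1"
  by (simp add: cubic_def algebra_simps power2_eq_square power3_eq_cube)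

lemma cubic_roots_unique:
  assumes r: "poly (cubic a) \<rho> = 0" "\<rho> > 1" "poly (cubic a) \<rho>' = 0" "-1 < \<rho>'" "\<rho>' < 0"
    "poly (cubic a) \<rho>'' = 0" "\<rho>'' < -1" and x: "poly (cubic a) x = 0"
  shows "x \<in> {\<rho>, \<rho>', \<rho>''}"
proof (rule ccontr)
  assume "x \<notin> {\<rho>, \<rho>', \<rho>''}"
  then have "card {x, \<rho>, \<rho>', \<rho>''} = 4" using r(2,4,5,7) by auto
  moreover have nz: "cubic a \<noteq> 0" by (simp add: cubic_def)
  have "card {x, \<rho>, \<rho>', \<rho>''} \<le> card {z. poly (cubic a) z = 0}"
    using r x by (intro card_mono poly_roots_finite nz) auto
  moreover have "card {z. poly (cubic a) z = 0} \<le> degree (cubic a)"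
    by (rule card_poly_roots_bound[OF nz])
  moreover have "degree (cubic a) = 3" by (simp add: cubic_def)
  ultimately show False by simp
qed

lemma cubic_roots_exist:
  assumes "a \<ge> 3"
  shows "\<exists>\<rho>>1. poly (cubic a) \<rho> = 0"
    and "\<exists>\<rho>'> -1. \<rho>' < 0 \<and> poly (cubic a) \<rho>' = 0"
    and "\<exists>\<rho>''< -1. poly (cubic a) \<rho>'' = 0"
proof -
  have A: "real_of_int a \<ge> 3" using assms by simp
  have 1: "poly (cubic a) 1 < 0" by (simp add: cubic_eval)
  have 2: "poly (cubic a) 2 > 0" using A by (simp add: cubic_eval)
  have 3: "poly (cubic a) 0 < 0" by (simp add: cubic_eval)
  have 4: "poly (cubic a) (-1) > 0" using A by (simp add: cubic_eval)
  have 5: "poly (cubic a) (- of_int a - 1) < 0"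
  proof -
    have "poly (cubic a) (- of_int a - 1) = - (of_int a + 1)\<^sup>2 * 2 + of_int a * (of_int a + 1) - 1"
      by (simp add: cubic_eval algebra_simps power2_eq_square power3_eq_cube)
    also have "\<dots> = - (of_int a)\<^sup>2 - 3 * of_int a - 3"
      by (simp add: algebra_simps power2_eq_square)
    also have "\<dots> < 0" using A zero_le_power2[of "real_of_int a"] by linarith
    finally show ?thesis .
  qed
  show "\<exists>\<rho>>1. poly (cubic a) \<rho> = 0"
    using poly_IVT_pos[OF _ 1 2] by auto
  show "\<exists>\<rho>'> -1. \<rho>' < 0 \<and> poly (cubic a) \<rho>' = 0"
    using poly_IVT_neg[OF _ 4 3] by auto
  show "\<exists>\<rho>''< -1. poly (cubic a) \<rho>'' = 0"
    using poly_IVT_pos[OF _ 5 4] A by auto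
qed

definition rat_eval :: "real \<Rightarrow> rat poly \<Rightarrow> real" where
  "rat_eval x p = poly (map_poly of_rat p) x"

lemma rat_eval_pCons [simp]: "rat_eval x (pCons c p) = of_rat c + x * rat_eval x p"
  by (simp add: rat_eval_def map_poly_pCons)

lemma rat_eval_0 [simp]: "rat_eval x 0 = 0"
  by (simp add: rat_eval_def)

lemma rat_eval_1 [simp]: "rat_eval x 1 = 1"
  by (simp add: one_pCons)

lemma rat_eval_add [simp]: "rat_eval x (p + q) = rat_eval x p + rat_eval x q"
  by (induction p q rule: poly_induct2) (simp_all add: of_rat_add algebra_simps)

lemma rat_eval_smult [simp]: "rat_eval x (smult c p) = of_rat c * rat_eval x p"
  by (induction p) (simp_all add: of_rat_mult algebra_simps)

lemma rat_eval_mult [simp]: "rat_eval x (p * q) = rat_eval x p * rat_eval x q"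
  by (induction p) (simp_all add: algebra_simps)

lemma rat_eval_minus [simp]: "rat_eval x (p - q) = rat_eval x p - rat_eval x q"
proof -
  have "rat_eval x p = rat_eval x ((p - q) + q)" by simp
  then show ?thesis by (simp only: rat_eval_add)
qed

lemma cubic_no_rat_root:
  fixes x :: rat
  assumes "a \<ge> 3"
  shows "x^3 + (of_int a - 1) * x^2 - of_int a * x - 1 \<noteq> 0"
proof
  assume eq: "x^3 + (of_int a - 1) * x^2 - of_int a * x - 1 = 0"
  define P where "P = [:-1, - of_int a, of_int a - 1, 1 :: rat:]"
  have "coeff P i \<in> \<int>" for i
    by (auto simp: P_def coeff_pCons split: nat.splits)
  moreover have "poly P x = 0"
    using eq by (simp add: P_def algebra_simps power2_eq_square power3_eq_cube)
  moreover have "lead_coeff P = 1" by (simp add: P_def)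
  ultimately have "algebraic_int x" by (auto intro: algebraic_int.intros)
  moreover have "x \<in> \<rat>"
    by (metis Rats_def of_rat_eq_id id_apply rangeI)
  ultimately have "x \<in> \<int>" by (rule rational_algebraic_int_is_int)
  then obtain m where m: "x = of_int m" by (auto elim: Ints_cases)
  from eq have "of_int (m^3 + (a - 1) * m^2 - a * m - 1) = (0 :: rat)"
    by (simp add: m)
  then have me: "m^3 + (a - 1) * m^2 - a * m - 1 = 0" by (simp only: of_int_eq_0_iff)
  then have "m * (m^2 + (a - 1) * m - a) = 1"
    by (simp add: algebra_simps power2_eq_square power3_eq_cube)
  then have "m = 1 \<or> m = -1" using zmult_eq_1_iff by blast
  then show False using me assms by auto
qed

lemma rat_eval_transfer:
  assumes a: "a \<ge> 3" and r: "poly (cubic a) r = 0" and t: "poly (cubic a) t = 0"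
    and p: "rat_eval r p = 0"
  shows "rat_eval t p = 0"
proof -
  define F where "F = [:-1, - of_int a, of_int a - 1, 1 :: rat:]"
  have F_eval: "rat_eval x F = poly (cubic a) x" for x
    by (simp add: F_def cubic_def of_rat_diff of_rat_minus)
  have F0: "F \<noteq> 0" and degF: "degree F = 3" by (auto simp: F_def)
  define Q where "Q = (\<lambda>d. d \<noteq> 0 \<and> rat_eval r d = 0)"
  have QF: "Q F" using F0 F_eval r by (simp add: Q_def)
  obtain d where d: "Q d" and dmin: "\<And>e. Q e \<Longrightarrow> degree d \<le> degree e"
    using ex_has_least_nat[of Q F degree] QF by blast
  have dvd: "d dvd e" if "rat_eval r e = 0" for e
  proof (rule ccontr)
    assume "\<not> d dvd e"
    then have nz: "e mod d \<noteq> 0" by (simp add: dvd_eq_mod_eq_0)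
    have "rat_eval r (e - d * (e div d)) = 0"
      using that d by (simp only: rat_eval_minus rat_eval_mult) (simp add: Q_def)
    then have "rat_eval r (e mod d) = 0" by (simp add: minus_mult_div_eq_mod)
    then have "Q (e mod d)" using nz by (simp add: Q_def)
    then show False using dmin[of "e mod d"] degree_mod_less[of d e] nz d
      by (auto simp: Q_def)
  qed
  have noroot: "degree g \<noteq> 1" if g: "g dvd F" for g
  proof
    assume "degree g = 1"
    then obtain b c where gc: "g = [:b, c:]" "c \<noteq> 0" using degree1_coeffs by blast
    define x where "x = - b / c"
    have "poly g x = 0" using gc by (simp add: x_def)
    then have "poly F x = 0" using g by (auto elim: dvdE)
    then show False using cubic_no_rat_root[OF a, of x]
      by (simp add: F_def algebra_simps power2_eq_square power3_eq_cube)
  qed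
  obtain h where h: "F = d * h" using dvd[of F] QF by (auto simp: Q_def elim: dvdE)
  have hd0: "d \<noteq> 0" "h \<noteq> 0" using F0 h by auto
  have deg: "degree d + degree h = 3" using degF h hd0 by (simp add: degree_mult_eq)
  have "degree d \<noteq> 0"
  proof
    assume "degree d = 0"
    then obtain c where "d = [:c:]" by (auto elim: degree_eq_zeroE)
    then show False using d by (simp add: Q_def)
  qed
  moreover have "degree d \<noteq> 1" "degree h \<noteq> 1" using noroot h by auto
  ultimately have "degree h = 0" using deg by linarith
  then obtain c where c: "h = [:c:]" by (auto elim: degree_eq_zeroE)
  have "rat_eval t (d * h) = 0" using F_eval[of t] t h by simp
  then have "rat_eval t d * of_rat c = 0" unfolding c rat_eval_mult by simp
  then have "rat_eval t d = 0" using c hd0 by auto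
  then show ?thesis using dvd[OF p] by (auto elim: dvdE)
qed

lemma embedding_exists:
  assumes a: "a \<ge> 3" and r: "poly (cubic a) r = 0" and t: "poly (cubic a) t = 0"
  shows "\<exists>\<sigma>. field_embedding (rat_adjoin r) \<sigma> \<and> \<sigma> r = t"
proof -
  define rep where
    "rep = (\<lambda>x pq. rat_eval r (snd pq) \<noteq> 0 \<and> x = rat_eval r (fst pq) / rat_eval r (snd pq))"
  define \<sigma> where "\<sigma> = (\<lambda>x. let pq = (SOME pq. rep x pq) in rat_eval t (fst pq) / rat_eval t (snd pq))"
  have \<sigma>: "\<sigma> (rat_eval r p / rat_eval r q) = rat_eval t p / rat_eval t q"
    if q: "rat_eval r q \<noteq> 0" for p q
  proof -
    let ?x = "rat_eval r p / rat_eval r q"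
    define pq where "pq = (SOME pq. rep ?x pq)"
    have "rep ?x (p, q)" using q by (simp add: rep_def)
    then have "rep ?x pq" unfolding pq_def by (rule someI)
    then have n: "rat_eval r (snd pq) \<noteq> 0"
      and e: "?x = rat_eval r (fst pq) / rat_eval r (snd pq)" by (auto simp: rep_def)
    have "rat_eval r (p * snd pq - fst pq * q) = 0"
      using n q e by (simp add: field_simps)
    then have "rat_eval t (p * snd pq - fst pq * q) = 0" by (rule rat_eval_transfer[OF a r t])
    moreover have "rat_eval t q \<noteq> 0" "rat_eval t (snd pq) \<noteq> 0"
      using q n rat_eval_transfer[OF a t r] by blast+
    ultimately have "rat_eval t (fst pq) / rat_eval t (snd pq) = rat_eval t p / rat_eval t q"
      by (simp add: field_simps)
    then show ?thesis by (simp add: \<sigma>_def Let_def pq_def)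
  qed
  have "\<sigma> 1 = 1" using \<sigma>[of 1 1] by simp
  moreover have "\<sigma> r = t" using \<sigma>[of 1 "[:0, 1:]"] \<sigma>[of "[:0, 1:]" 1] by simp
  moreover have "\<sigma> (x + y) = \<sigma> x + \<sigma> y \<and> \<sigma> (x * y) = \<sigma> x * \<sigma> y"
    if "x \<in> rat_adjoin r" "y \<in> rat_adjoin r" for x y
  proof -
    obtain p q where x: "x = rat_eval r p / rat_eval r q" and q: "rat_eval r q \<noteq> 0"
      using \<open>x \<in> rat_adjoin r\<close> by (auto simp: rat_adjoin_def rat_eval_def)
    obtain p' q' where y: "y = rat_eval r p' / rat_eval r q'" and q': "rat_eval r q' \<noteq> 0"
      using \<open>y \<in> rat_adjoin r\<close> by (auto simp: rat_adjoin_def rat_eval_def)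
    have tq: "rat_eval t q \<noteq> 0" "rat_eval t q' \<noteq> 0"
      using q q' rat_eval_transfer[OF a t r] by blast+
    have qq: "rat_eval r (q * q') \<noteq> 0" using q q' by simp
    have "x + y = rat_eval r (p * q' + p' * q) / rat_eval r (q * q')"
      using q q' by (simp add: x y field_simps)
    then have s: "\<sigma> (x + y) = rat_eval t (p * q' + p' * q) / rat_eval t (q * q')"
      by (simp only: \<sigma>[OF qq])
    have "x * y = rat_eval r (p * p') / rat_eval r (q * q')"
      by (simp add: x y)
    then have m: "\<sigma> (x * y) = rat_eval t (p * p') / rat_eval t (q * q')"
      by (simp only: \<sigma>[OF qq])
    have e: "\<sigma> x = rat_eval t p / rat_eval t q" "\<sigma> y = rat_eval t p' / rat_eval t q'"
      using \<sigma>[OF q] \<sigma>[OF q'] by (simp_all add: x y)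
    show ?thesis unfolding s m e using tq by (simp add: field_simps)
  qed
  ultimately show ?thesis by (auto simp: field_embedding_def)
qed

end

theory Submission
  imports Defs "HOL-Library.Product_Plus"
begin

text \<open>
  Multiplying by \<open>\<plusminus>1\<close> and \<open>\<plusminus>\<rho>\<close> reduces every signature to \<open>+++\<close> or \<open>+-+\<close>. On each of these two
  octants, modulo the group \<open>V\<close> of totally positive units, the lattice \<open>\<int>[\<rho>]\<close> is governed by two
  integral linear forms: trace forms \<open>\<alpha> \<mapsto> Tr (g \<alpha> / f'(\<rho>))\<close> with \<open>g\<close> of the appropriate
  signature, hence positive on the octant. Choose \<open>\<epsilon> \<in> V\<close> and one of the two forms such that its
  value at \<open>\<epsilon> \<alpha>\<close> is minimal; such a choice exists because the values are positive integers. The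
  inequalities against finitely many competitors say exactly that \<open>\<epsilon> \<alpha>\<close> lies in the rational cone
  over one facet of the convex hull of the lattice points, and there listed elements (or their
  associates) can be split off. This shows that every indecomposable element is associated with a
  listed one, and also bounds the forms from below on the whole octant; the listed elements take
  values too small for a sum of two elements of the octant.
\<close>

section \<open>Arithmetic of the order\<close>

text \<open>The triple \<open>(x, y, z)\<close> stands for \<open>x + y\<rho> + z\<rho>\<^sup>2\<close>.\<close>

type_synonym triple = "int \<times> int \<times> int"

fun ev :: "real \<Rightarrow> triple \<Rightarrow> real" where
  "ev r (x, y, z) = of_int x + of_int y * r + of_int z * r\<^sup>2"

text \<open>The product reduced by \<rho>^3 = 1 + a\<rho> - (a - 1)\<rho>^2, in explicit
  coordinates, so that products with concrete units are evaluated by rewriting.\<close>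

fun mul :: "int \<Rightarrow> triple \<Rightarrow> triple \<Rightarrow> triple" where
  "mul a (x, y, z) (x', y', z') =
     (x * x' + (y * z' + z * y') - (a - 1) * (z * z'),
      x * y' + y * x' + a * (y * z' + z * y') + (1 - a * (a - 1)) * (z * z'),
      x * z' + y * y' + z * x' - (a - 1) * (y * z' + z * y') + (a + (a - 1)\<^sup>2) * (z * z'))"

lemma ev_add: "ev r (s + t) = ev r s + ev r t"
  by (cases s; cases t) (simp add: algebra_simps)

lemma ev_zero: "ev r 0 = 0"
  by (simp add: zero_prod_def)

lemma quadratic_product:
  fixes r a x y z x' y' z' :: real
  assumes r: "r ^ 3 = 1 + a * r - (a - 1) * r\<^sup>2"
  shows "(x + y * r + z * r\<^sup>2) * (x' + y' * r + z' * r\<^sup>2) =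
      (x * x' + (y * z' + z * y') - (a - 1) * (z * z'))
    + (x * y' + y * x' + a * (y * z' + z * y') + (1 - a * (a - 1)) * (z * z')) * r
    + (x * z' + y * y' + z * x' - (a - 1) * (y * z' + z * y') + (a + (a - 1)\<^sup>2) * (z * z')) * r\<^sup>2"
proof -
  have "r ^ 4 = r * r ^ 3" by (simp add: eval_nat_numeral)
  also have "\<dots> = r * (1 + a * r - (a - 1) * r\<^sup>2)" by (simp only: r)
  also have "\<dots> = r + a * r\<^sup>2 - (a - 1) * r ^ 3"
    by (simp add: algebra_simps power2_eq_square power3_eq_cube)
  also have "\<dots> = - (a - 1) + (1 - a * (a - 1)) * r + (a + (a - 1)\<^sup>2) * r\<^sup>2"
    unfolding r by (simp add: algebra_simps power2_eq_square)
  finally have r4: "r ^ 4 = - (a - 1) + (1 - a * (a - 1)) * r + (a + (a - 1)\<^sup>2) * r\<^sup>2" .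
  have "(x + y * r + z * r\<^sup>2) * (x' + y' * r + z' * r\<^sup>2) = x * x' + (x * y' + y * x') * r
      + (x * z' + y * y' + z * x') * r\<^sup>2 + (y * z' + z * y') * r ^ 3 + (z * z') * r ^ 4"
    by (simp add: algebra_simps eval_nat_numeral)
  then show ?thesis unfolding r r4 by (simp add: algebra_simps)
qed

lemma ev_mul:
  assumes "r ^ 3 = 1 + of_int a * r - (of_int a - 1) * r\<^sup>2"
  shows "ev r (mul a s t) = ev r s * ev r t"
  by (cases s; cases t) (simp add: quadratic_product[OF assms])

locale three_roots =
  fixes a :: int and r\<^sub>1 r\<^sub>2 r\<^sub>3 :: real
  assumes a3: "3 \<le> a"
    and root1: "poly (cubic a) r\<^sub>1 = 0" and root2: "poly (cubic a) r\<^sub>2 = 0"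
    and root3: "poly (cubic a) r\<^sub>3 = 0"
    and r1: "1 < r\<^sub>1" and r2: "-1 < r\<^sub>2" "r\<^sub>2 < 0" and r3: "r\<^sub>3 < -1"
begin

lemma a3': "3 \<le> real_of_int a"
  using a3 by simp

lemma cube:
  assumes "poly (cubic a) r = 0"
  shows "r ^ 3 = 1 + of_int a * r - (of_int a - 1) * r\<^sup>2"
  using assms by (simp add: cubic_eval)

lemmas cube1 = cube[OF root1] and cube2 = cube[OF root2] and cube3 = cube[OF root3]

lemmas ev_mul1 = ev_mul[OF cube1] and ev_mul2 = ev_mul[OF cube2] and ev_mul3 = ev_mul[OF cube3]

text \<open>The cubic is x(x - 1)(x + a) - 1, so \<rho>, \<rho> - 1 and \<rho> + a are units. The
  bounds on the roots and the explicit units below rest on this factorization.\<close>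

lemma unit_inverse:
  assumes "poly (cubic a) r = 0"
  shows "r * (r - 1) * (r + of_int a) = 1"
  using cube[OF assms] by (simp add: algebra_simps power2_eq_square power3_eq_cube)

lemma ev_transfer:
  assumes r: "poly (cubic a) r = 0" and s: "poly (cubic a) s = 0" and t: "ev r t = 0"
  shows "ev s t = 0"
proof -
  obtain x y z where xyz: "t = (x, y, z)" by (metis surj_pair)
  have e: "rat_eval q [:of_int x, of_int y, of_int z:] = ev q t" for q
    by (simp add: xyz algebra_simps power2_eq_square)
  show ?thesis using rat_eval_transfer[OF a3 r s] t unfolding e[symmetric] .
qed

text \<open>By irreducibility of the cubic the value vanishes at all three roots; divided
  differences then eliminate the coefficients one after another.\<close>

lemma ev_eq_0:
  assumes "ev r\<^sub>1 t = 0"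
  shows "t = 0"
proof -
  obtain x y z where xyz: "t = (x, y, z)" by (metis surj_pair)
  have e1: "ev r\<^sub>1 t = 0" and e2: "ev r\<^sub>2 t = 0" and e3: "ev r\<^sub>3 t = 0"
    using assms ev_transfer[OF root1 root2] ev_transfer[OF root1 root3] by auto
  have "(r\<^sub>1 - r\<^sub>2) * (of_int y + of_int z * (r\<^sub>1 + r\<^sub>2)) = ev r\<^sub>1 t - ev r\<^sub>2 t"
    by (simp add: xyz algebra_simps power2_eq_square)
  then have d12: "of_int y + of_int z * (r\<^sub>1 + r\<^sub>2) = 0" using e1 e2 r1 r2 by auto
  have "(r\<^sub>1 - r\<^sub>3) * (of_int y + of_int z * (r\<^sub>1 + r\<^sub>3)) = ev r\<^sub>1 t - ev r\<^sub>3 t"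
    by (simp add: xyz algebra_simps power2_eq_square)
  then have d13: "of_int y + of_int z * (r\<^sub>1 + r\<^sub>3) = 0" using e1 e3 r1 r3 by auto
  have "of_int z * (r\<^sub>2 - r\<^sub>3)
      = (of_int y + of_int z * (r\<^sub>1 + r\<^sub>2)) - (of_int y + of_int z * (r\<^sub>1 + r\<^sub>3))"
    by (simp add: algebra_simps)
  then have "of_int z * (r\<^sub>2 - r\<^sub>3) = 0" unfolding d12 d13 by simp
  then have z: "z = 0" using r2 r3 by auto
  then have "y = 0" using d12 by simp
  then show ?thesis using z e1 by (simp add: xyz zero_prod_def)
qed

text \<open>Ring laws for \<open>mul\<close> can thus be read off from the real numbers.\<close>

lemma ev_inject:
  assumes "ev r\<^sub>1 s = ev r\<^sub>1 t"
  shows "s = t"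
proof -
  have "ev r\<^sub>1 ((s - t) + t) = ev r\<^sub>1 (s - t) + ev r\<^sub>1 t" by (rule ev_add)
  then have "ev r\<^sub>1 (s - t) = 0" using assms by simp
  then show ?thesis using ev_eq_0[of "s - t"] by simp
qed

lemma mul_commute: "mul a s t = mul a t s"
  by (rule ev_inject) (simp add: ev_mul1)

lemma mul_assoc: "mul a (mul a s t) w = mul a s (mul a t w)"
  by (rule ev_inject) (simp add: ev_mul1)

lemma mul_add: "mul a w (s + t) = mul a w s + mul a w t"
  by (rule ev_inject) (simp add: ev_mul1 ev_add algebra_simps)

lemma mul_one: "mul a (1, 0, 0) t = t"
  by (cases t) simp

section \<open>Octants, totally positive units and decomposability\<close>

definition invertible :: "triple \<Rightarrow> bool" where
  "invertible u \<longleftrightarrow> (\<exists>v. mul a u v = (1, 0, 0))"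

definition pos :: "triple \<Rightarrow> bool" where
  "pos t \<longleftrightarrow> 0 < ev r\<^sub>1 t \<and> 0 < ev r\<^sub>2 t \<and> 0 < ev r\<^sub>3 t"

definition mix :: "triple \<Rightarrow> bool" where
  "mix t \<longleftrightarrow> 0 < ev r\<^sub>1 t \<and> ev r\<^sub>2 t < 0 \<and> 0 < ev r\<^sub>3 t"

definition pos_unit :: "triple \<Rightarrow> bool" where
  "pos_unit u \<longleftrightarrow> pos u \<and> invertible u"

definition same_signs :: "triple \<Rightarrow> triple \<Rightarrow> bool" where
  "same_signs s t \<longleftrightarrow> sgn (ev r\<^sub>1 s) = sgn (ev r\<^sub>1 t) \<and> sgn (ev r\<^sub>2 s) = sgn (ev r\<^sub>2 t)
     \<and> sgn (ev r\<^sub>3 s) = sgn (ev r\<^sub>3 t)"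

text \<open>Comparing the summands with \<open>t\<close> itself treats all signatures at
  once.\<close>

definition decomposable :: "triple \<Rightarrow> bool" where
  "decomposable t \<longleftrightarrow> (\<exists>b c. same_signs b t \<and> same_signs c t \<and> t = b + c)"

lemma invertible_mul:
  assumes "invertible u" "invertible v"
  shows "invertible (mul a u v)"
proof -
  obtain u' v' where "mul a u u' = (1, 0, 0)" "mul a v v' = (1, 0, 0)"
    using assms unfolding invertible_def by blast
  then have "mul a (mul a u v) (mul a u' v') = (1, 0, 0)"
    by (metis mul_assoc mul_commute mul_one)
  then show ?thesis unfolding invertible_def by blast
qed

lemma pos_unit_mul: "pos_unit u \<Longrightarrow> pos_unit v \<Longrightarrow> pos_unit (mul a u v)"
  unfolding pos_unit_def pos_def by (simp add: invertible_mul ev_mul1 ev_mul2 ev_mul3)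

lemma pos_mul: "pos_unit u \<Longrightarrow> pos t \<Longrightarrow> pos (mul a u t)"
  unfolding pos_unit_def pos_def by (simp add: ev_mul1 ev_mul2 ev_mul3)

lemma pos_times_mix: "pos s \<Longrightarrow> mix t \<Longrightarrow> mix (mul a s t)"
  unfolding pos_def mix_def by (simp add: ev_mul1 ev_mul2 ev_mul3 mult_pos_neg)

lemma mix_mul: "pos_unit u \<Longrightarrow> mix t \<Longrightarrow> mix (mul a u t)"
  unfolding pos_unit_def using pos_times_mix by blast

lemma pos_unit_inverse:
  assumes "pos_unit u"
  obtains v where "pos_unit v" "mul a v u = (1, 0, 0)"
proof -
  obtain v where v: "mul a u v = (1, 0, 0)"
    using assms unfolding pos_unit_def invertible_def by blast
  have "ev r\<^sub>1 u * ev r\<^sub>1 v = 1" "ev r\<^sub>2 u * ev r\<^sub>2 v = 1" "ev r\<^sub>3 u * ev r\<^sub>3 v = 1"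
    using ev_mul1[of u v] ev_mul2[of u v] ev_mul3[of u v] v by simp_all
  then have "pos v"
    using assms unfolding pos_unit_def pos_def
    by (metis zero_less_mult_pos zero_less_one)
  then have "pos_unit v" using v unfolding pos_unit_def invertible_def by (metis mul_commute)
  then show ?thesis using that v mul_commute by metis
qed

text \<open>Multiplication by the inverse of \<open>w\<close> is additive and affects the signs of
  the sum and of both summands alike.\<close>

lemma decomposable_mul:
  assumes w: "invertible w" and d: "decomposable (mul a w t)"
  shows "decomposable t"
proof -
  obtain w' where w': "mul a w w' = (1, 0, 0)" using w unfolding invertible_def by blast
  obtain b c where bc: "same_signs b (mul a w t)" "same_signs c (mul a w t)" "mul a w t = b + c"
    using d unfolding decomposable_def by blast
  have e: "ev r\<^sub>1 w * ev r\<^sub>1 w' = 1" "ev r\<^sub>2 w * ev r\<^sub>2 w' = 1" "ev r\<^sub>3 w * ev r\<^sub>3 w' = 1"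
    using ev_mul1[of w w'] ev_mul2[of w w'] ev_mul3[of w w'] w' by simp_all
  have "t = mul a w' (mul a w t)"
    using w' by (metis mul_assoc mul_commute mul_one)
  then have "t = mul a w' b + mul a w' c" using bc(3) mul_add by simp
  moreover have ss: "same_signs (mul a w' b) t" if "same_signs b (mul a w t)" for b
  proof -
    have s: "sgn (y' * x) = sgn z" if "y * y' = 1" "sgn x = sgn (y * z)" for x y y' z :: real
    proof -
      have "sgn (y' * x) = sgn (y * y') * sgn z"
        by (simp only: sgn_mult that(2) mult.commute mult.left_commute mult.assoc)
      then show ?thesis using that(1) by simp
    qed
    show ?thesis
      using that e unfolding same_signs_def by (simp add: ev_mul1 ev_mul2 ev_mul3 s)
  qed
  ultimately show ?thesis using ss[OF bc(1)] ss[OF bc(2)] unfolding decomposable_def by blast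
qed

text \<open>Well-ordering, applied to the smaller of the two form values over the orbit. Since the
  totally positive units form a group, the minimum can be compared with all further translates by
  \<open>w\<close>; the outcomes tell which form attains it.\<close>

lemma orbit_minimum:
  fixes F G :: "triple \<Rightarrow> int"
  assumes F: "\<forall>u. pos_unit u \<longrightarrow> 0 \<le> F (mul a u t)" and G: "\<forall>u. pos_unit u \<longrightarrow> 0 \<le> G (mul a u t)"
  obtains (first) u where "pos_unit u"
      "\<And>w. pos_unit w \<Longrightarrow> F (mul a u t) \<le> F (mul a w (mul a u t))"
      "\<And>w. pos_unit w \<Longrightarrow> F (mul a u t) \<le> G (mul a w (mul a u t))"
    | (second) u where "pos_unit u"
      "\<And>w. pos_unit w \<Longrightarrow> G (mul a u t) \<le> F (mul a w (mul a u t))"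
      "\<And>w. pos_unit w \<Longrightarrow> G (mul a u t) \<le> G (mul a w (mul a u t))"
proof -
  define m where "m = (\<lambda>u. nat (min (F (mul a u t)) (G (mul a u t))))"
  have "pos_unit (1, 0, 0)"
    unfolding pos_unit_def pos_def invertible_def by (auto simp: mul_one)
  then obtain u where u: "pos_unit u" and least: "\<And>w. pos_unit w \<Longrightarrow> m u \<le> m w"
    using ex_has_least_nat[of pos_unit "(1, 0, 0)" m] by blast
  have le: "min (F (mul a u t)) (G (mul a u t)) \<le> F (mul a w (mul a u t))"
    "min (F (mul a u t)) (G (mul a u t)) \<le> G (mul a w (mul a u t))" if "pos_unit w" for w
    using least[of "mul a w u"] pos_unit_mul[OF that u] F[rule_format, OF pos_unit_mul[OF that u]]
      G[rule_format, OF pos_unit_mul[OF that u]] by (auto simp: m_def mul_assoc)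
  show ?thesis
  proof (cases "F (mul a u t) \<le> G (mul a u t)")
    case True
    show ?thesis by (rule first[OF u]) (use le True in auto)
  next
    case False
    show ?thesis by (rule second[OF u]) (use le False in auto)
  qed
qed

section \<open>Units and positive linear forms\<close>

lemma r1_less_2: "r\<^sub>1 < 2"
proof (rule ccontr)
  assume "\<not> r\<^sub>1 < 2"
  then have "2 * 1 * 1 \<le> r\<^sub>1 * (r\<^sub>1 - 1) * (r\<^sub>1 + of_int a)"
    using a3' by (intro mult_mono) auto
  then show False using unit_inverse[OF root1] by simp
qed

lemma r2_bound: "- 1 / 2 < r\<^sub>2"
proof (rule ccontr)
  assume "\<not> - 1 / 2 < r\<^sub>2"
  then have "(1/2) * (3/2) * 2 \<le> (- r\<^sub>2) * (1 - r\<^sub>2) * (r\<^sub>2 + of_int a)"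
    using a3' r2 by (intro mult_mono mult_nonneg_nonneg) auto
  moreover have "(- r\<^sub>2) * (1 - r\<^sub>2) * (r\<^sub>2 + of_int a) = r\<^sub>2 * (r\<^sub>2 - 1) * (r\<^sub>2 + of_int a)"
    by (simp add: algebra_simps)
  ultimately show False using unit_inverse[OF root2] by simp
qed

lemma r3_bound: "0 < r\<^sub>3 + of_int a"
proof -
  have "0 < r\<^sub>3 * (r\<^sub>3 - 1)" using r3 by (intro mult_neg_neg) auto
  then show ?thesis using unit_inverse[OF root3] by (metis zero_less_mult_pos zero_less_one)
qed

section \<open>Explicit totally positive units\<close>

lemma pos_unitI:
  assumes "mul a u v = (1, 0, 0)" "pos u"
  shows "pos_unit u" "pos_unit v"
proof -
  show u: "pos_unit u" using assms unfolding pos_unit_def invertible_def by blast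
  obtain v' where "pos_unit v'" "mul a v' u = (1, 0, 0)" using pos_unit_inverse[OF u] .
  moreover from this have "v = v'" using assms(1) by (metis mul_assoc mul_commute mul_one)
  ultimately show "pos_unit v" by simp
qed

lemma pos_unit_one: "pos_unit (1, 0, 0)"
  by (rule pos_unitI[of _ "(1, 0, 0)"]) (simp_all add: pos_def)

text \<open>The inverse is recorded too, because both units occur as competitors in the
  reductions.\<close>

lemma pos_unit_rho2: "pos_unit (0, 0, 1)" "pos_unit (a\<^sup>2 + a - 1, - a\<^sup>2 + a + 1, - a)"
proof -
  have 1: "mul a (0, 0, 1) (a\<^sup>2 + a - 1, - a\<^sup>2 + a + 1, - a) = (1, 0, 0)"
    by (simp add: algebra_simps power2_eq_square)
  have 2: "pos (0, 0, 1)" using r1 r2 r3 by (simp add: pos_def)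
  show "pos_unit (0, 0, 1)" "pos_unit (a\<^sup>2 + a - 1, - a\<^sup>2 + a + 1, - a)"
    using pos_unitI[OF 1 2] by auto
qed

lemma pos_unit_rho_plus_a: "pos_unit (a, 1, 0)" "pos_unit (0, -1, 1)"
proof -
  have 1: "mul a (a, 1, 0) (0, -1, 1) = (1, 0, 0)"
    by (simp add: algebra_simps power2_eq_square)
  have 2: "pos (a, 1, 0)" using r1 r2 r3_bound a3' by (simp add: pos_def)
  show "pos_unit (a, 1, 0)" "pos_unit (0, -1, 1)"
    using pos_unitI[OF 1 2] by auto
qed

lemma pos_unit_rho2_times_rho_plus_a: "pos_unit (1, a, 1)" "pos_unit (a + 1, 1 - a, -1)"
proof -
  have "mul a (0, 0, 1) (a, 1, 0) = (1, a, 1)"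
    by (simp add: algebra_simps power2_eq_square)
  then show 1: "pos_unit (1, a, 1)" using pos_unit_mul[OF pos_unit_rho2(1) pos_unit_rho_plus_a(1)] by simp
  have 2: "mul a (1, a, 1) (a + 1, 1 - a, -1) = (1, 0, 0)"
    by (simp add: algebra_simps power2_eq_square)
  show "pos_unit (a + 1, 1 - a, -1)"
    using pos_unitI(2)[OF 2] 1 unfolding pos_unit_def by auto
qed

text \<open>
  The last coordinate of \<open>\<alpha>\<close> is \<open>Tr (\<alpha> / f'(\<rho>))\<close>, and \<open>f'(\<rho>)\<close> has signature \<open>+-+\<close>.
\<close>

lemma last_coordinate_pos:
  assumes "mix (x, y, z)"
  shows "0 < z"
proof -
  let ?D = "(r\<^sub>1 - r\<^sub>2) * (r\<^sub>1 - r\<^sub>3) * (r\<^sub>2 - r\<^sub>3)"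
  \<comment> \<open>Lagrange interpolation for the leading coefficient, multiplied by the
    Vandermonde product.\<close>
  have "?D * of_int z = (r\<^sub>2 - r\<^sub>3) * ev r\<^sub>1 (x, y, z) + (r\<^sub>1 - r\<^sub>3) * (- ev r\<^sub>2 (x, y, z))
      + (r\<^sub>1 - r\<^sub>2) * ev r\<^sub>3 (x, y, z)"
    by (simp add: algebra_simps power2_eq_square)
  moreover have "0 < (r\<^sub>2 - r\<^sub>3) * ev r\<^sub>1 (x, y, z)" "0 < (r\<^sub>1 - r\<^sub>3) * (- ev r\<^sub>2 (x, y, z))"
    "0 < (r\<^sub>1 - r\<^sub>2) * ev r\<^sub>3 (x, y, z)"
    using assms r1 r2 r3 unfolding mix_def by (intro mult_pos_pos; linarith)+
  ultimately have "0 < ?D * of_int z" by linarith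
  moreover have "0 < ?D" using r1 r2 r3 by (intro mult_pos_pos) auto
  ultimately have "0 < real_of_int z" by (rule zero_less_mult_pos)
  then show ?thesis by simp
qed

text \<open>
  Up to a common factor \<open>a\<close> (for \<open>F\<^sub>1\<close>, \<open>F\<^sub>2\<close>) or \<open>2\<close> (for \<open>H\<close>, \<open>G\<close>) that makes them integral,
  \<open>F\<^sub>1\<close> is \<open>1\<close> on the facet with vertices \<open>1\<close>, \<open>\<rho>\<^sup>2\<close>, \<open>\<rho>\<^sup>2(\<rho> + a)\<close>; \<open>F\<^sub>2\<close> on the one with vertices
  \<open>1\<close>, \<open>\<rho> + a\<close>, \<open>\<rho>\<^sup>2(\<rho> + a)\<close>; \<open>H\<close> on the pentagon whose lattice points are the elements of the third
  listed family and some associates; \<open>G\<close> on the triangle with vertices \<open>\<rho>\<^sup>2 - 1\<close>,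
  \<open>-1 - (a - 1)\<rho> + a\<rho>\<^sup>2\<close>, \<open>\<rho> + \<rho>\<^sup>2\<close>.
\<close>

fun F\<^sub>1 :: "triple \<Rightarrow> int" where
  "F\<^sub>1 (x, y, z) = a * x - y + a * z"

fun F\<^sub>2 :: "triple \<Rightarrow> int" where
  "F\<^sub>2 (x, y, z) = a * (x - (a - 1) * y + a * (a - 1) * z)"

fun H :: "triple \<Rightarrow> int" where
  "H (x, y, z) = 2 * (y + z)"

fun G :: "triple \<Rightarrow> int" where
  "G (x, y, z) = y + z - x"

text \<open>\<open>F\<^sub>1 t\<close> is the last coordinate of \<open>t\<close> times an element
  of signature +-+. That element is the product of \<rho> + a and (a + 1)(\<rho>^2 - 1) - \<rho>,
  whose signs are easier to check.\<close>

lemma F1_pos: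
  assumes "pos t"
  shows "0 < F\<^sub>1 t"
proof -
  have "mix (- (a + 1), - 1, a + 1)"
  proof -
    have 1: "0 < (of_int a + 1) * (r\<^sub>1\<^sup>2 - 1) - r\<^sub>1"
    proof (rule ccontr)
      assume "\<not> ?thesis"
      then have "(of_int a + 1) * (r\<^sub>1\<^sup>2 - 1) \<le> r\<^sub>1" by simp
      \<comment> \<open>The factor r(r + a) cancels r - 1 and leaves a + r \<le> r^2, impossible for
        r < 2.\<close>
      then have "(of_int a + 1) * (r\<^sub>1\<^sup>2 - 1) * (r\<^sub>1 * (r\<^sub>1 + of_int a)) \<le> r\<^sub>1 * (r\<^sub>1 * (r\<^sub>1 + of_int a))"
        using r1 a3' by (intro mult_right_mono) auto
      moreover have "(of_int a + 1) * (r\<^sub>1\<^sup>2 - 1) * (r\<^sub>1 * (r\<^sub>1 + of_int a))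
          = (of_int a + 1) * (r\<^sub>1 + 1) * (r\<^sub>1 * (r\<^sub>1 - 1) * (r\<^sub>1 + of_int a))"
        by (simp add: algebra_simps power2_eq_square)
      moreover have "r\<^sub>1 * (r\<^sub>1 * (r\<^sub>1 + of_int a)) = 1 + of_int a * r\<^sub>1 + r\<^sub>1\<^sup>2"
        using cube1 by (simp add: algebra_simps power2_eq_square power3_eq_cube)
      ultimately have "(of_int a + 1) * (r\<^sub>1 + 1) \<le> 1 + of_int a * r\<^sub>1 + r\<^sub>1\<^sup>2"
        unfolding unit_inverse[OF root1] by simp
      then have "of_int a + r\<^sub>1 \<le> r\<^sub>1 * r\<^sub>1"
        by (simp add: algebra_simps power2_eq_square)
      moreover have "r\<^sub>1 * r\<^sub>1 \<le> 2 * r\<^sub>1" using r1 r1_less_2 by (intro mult_right_mono) auto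
      ultimately show False using r1_less_2 a3' by linarith
    qed
    have 2: "(of_int a + 1) * (r\<^sub>2\<^sup>2 - 1) - r\<^sub>2 < 0"
    proof -
      have "(- r\<^sub>2) * (- r\<^sub>2) \<le> (1/2) * (1/2)"
        using r2 r2_bound by (intro mult_mono) auto
      then have s: "r\<^sub>2\<^sup>2 - 1 \<le> - 3 / 4" by (simp add: power2_eq_square)
      have "(of_int a + 1) * (r\<^sub>2\<^sup>2 - 1) \<le> 4 * (r\<^sub>2\<^sup>2 - 1)"
        using a3' s by (intro mult_right_mono_neg) auto
      also have "\<dots> \<le> - 3" using s by simp
      finally show ?thesis using r2_bound by linarith
    qed
    have 3: "0 < (of_int a + 1) * (r\<^sub>3\<^sup>2 - 1) - r\<^sub>3"
    proof -
      have "1 * 1 < (- r\<^sub>3) * (- r\<^sub>3)" using r3 by (intro mult_strict_mono) auto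
      then have "0 \<le> (of_int a + 1) * (r\<^sub>3\<^sup>2 - 1)"
        using a3' by (intro mult_nonneg_nonneg) (auto simp: power2_eq_square)
      then show ?thesis using r3 by linarith
    qed
    show ?thesis using 1 2 3 unfolding mix_def by (simp add: algebra_simps)
  qed
  then have "mix (mul a (a, 1, 0) (- (a + 1), - 1, a + 1))"
    by (rule mix_mul[OF pos_unit_rho_plus_a(1)])
  then have m: "mix (1 - a\<^sup>2, a\<^sup>2 - a - 1, a)"
    by (simp add: algebra_simps power2_eq_square)
  obtain x y z where t: "t = (x, y, z)" by (metis surj_pair)
  have "mix (mul a t (1 - a\<^sup>2, a\<^sup>2 - a - 1, a))" using assms m by (rule pos_times_mix)
  from last_coordinate_pos[OF this[unfolded t mul.simps]] show ?thesis
    by (simp add: t algebra_simps power2_eq_square)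
qed

text \<open>\<open>F\<^sub>2 t\<close> is \<open>a\<close> times the last coordinate of (\<rho>^2 -
  1)t, a positive integer.\<close>

lemma F2_lower_bound:
  assumes "pos t"
  shows "a \<le> F\<^sub>2 t"
proof -
  have "mix (- 1, 0, 1)"
  proof -
    have "1 * 1 < r\<^sub>1 * r\<^sub>1" using r1 by (intro mult_strict_mono) auto
    moreover have "(- r\<^sub>2) * (- r\<^sub>2) < 1 * 1" using r2 by (intro mult_strict_mono) auto
    moreover have "1 * 1 < (- r\<^sub>3) * (- r\<^sub>3)" using r3 by (intro mult_strict_mono) auto
    ultimately show ?thesis unfolding mix_def by (simp add: power2_eq_square)
  qed
  obtain x y z where t: "t = (x, y, z)" by (metis surj_pair)
  have "mix (mul a t (- 1, 0, 1))" using assms \<open>mix (- 1, 0, 1)\<close> by (rule pos_times_mix)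
  from last_coordinate_pos[OF this[unfolded t mul.simps]]
  have "1 \<le> x - (a - 1) * y + a * (a - 1) * z" by (simp add: algebra_simps power2_eq_square)
  then have "a * 1 \<le> a * (x - (a - 1) * y + a * (a - 1) * z)"
    using a3 by (intro mult_left_mono) auto
  then show ?thesis by (simp add: t)
qed

text \<open>Half of \<open>H t\<close> is the last coordinate of (\<rho> + a)t.\<close>

lemma H_lower_bound:
  assumes "mix t"
  shows "2 \<le> H t"
proof -
  obtain x y z where t: "t = (x, y, z)" by (metis surj_pair)
  have "mix (mul a (a, 1, 0) t)" using pos_unit_rho_plus_a(1) assms by (rule mix_mul)
  from last_coordinate_pos[OF this[unfolded t mul.simps]] show ?thesis
    by (simp add: t algebra_simps)
qed

text \<open>\<open>G t\<close> is the last coordinate of (2 - \<rho>)(\<rho> + a)t, and the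
  multiplier is totally positive.\<close>

lemma G_pos:
  assumes "mix t"
  shows "0 < G t"
proof -
  have "0 < (2 - r\<^sub>1) * (r\<^sub>1 + of_int a)" "0 < (2 - r\<^sub>2) * (r\<^sub>2 + of_int a)"
    "0 < (2 - r\<^sub>3) * (r\<^sub>3 + of_int a)"
    using r1 r1_less_2 r2 r3 r3_bound a3' by (intro mult_pos_pos; linarith)+
  then have p: "pos (2 * a, 2 - a, - 1)"
    unfolding pos_def by (simp add: algebra_simps power2_eq_square)
  obtain x y z where t: "t = (x, y, z)" by (metis surj_pair)
  have "mix (mul a (2 * a, 2 - a, - 1) t)" using p assms by (rule pos_times_mix)
  from last_coordinate_pos[OF this[unfolded t mul.simps]] show ?thesis
    by (simp add: t algebra_simps power2_eq_square)
qed

section \<open>Reduction to the cones over the facets\<close>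

lemma pos_reduction:
  assumes "pos t"
  obtains (first) u x y z where "pos_unit u" "mul a u t = (x, y, z)" "pos (x, y, z)"
      "0 \<le> y" "y \<le> a * x" "y \<le> a * z" "F\<^sub>1 (x, y, z) \<le> F\<^sub>1 t"
    | (second) u x y z where "pos_unit u" "mul a u t = (x, y, z)" "pos (x, y, z)"
      "0 \<le> z" "a * z \<le> y" "a * (y - a * z) + z \<le> x" "F\<^sub>2 (x, y, z) \<le> F\<^sub>1 t"
proof -
  \<comment> \<open>The original \<open>t\<close> is itself a competitor, whence the final bounds by
    \<open>F\<^sub>1 t\<close>.\<close>
  have undo: "\<exists>w. pos_unit w \<and> mul a w (mul a u t) = t" if u: "pos_unit u" for u
    using pos_unit_inverse[OF u] by (metis mul_assoc mul_one)
  have aa: "0 < a * a - a - 1"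
  proof -
    have "3 * 2 \<le> a * (a - 1)" using a3 by (intro mult_mono) auto
    then show ?thesis by (simp add: algebra_simps)
  qed
  have "\<forall>u. pos_unit u \<longrightarrow> 0 \<le> F\<^sub>1 (mul a u t)" "\<forall>u. pos_unit u \<longrightarrow> 0 \<le> F\<^sub>2 (mul a u t)"
    using F1_pos[OF pos_mul[OF _ assms]] F2_lower_bound[OF pos_mul[OF _ assms]] a3
    by (force intro: less_imp_le)+
  then show ?thesis
  proof (cases rule: orbit_minimum[of F\<^sub>1 t F\<^sub>2])
    case (first u)
    obtain x y z where s: "mul a u t = (x, y, z)" by (metis surj_pair)
    note min1 = first(2)[unfolded s] and min2 = first(3)[unfolded s]
    \<comment> \<open>Each of the three competitors agrees with \<open>F\<^sub>1\<close> on one edge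
      of the facet, so the difference is a positive multiple of one coordinate relative to its
      vertices.\<close>
    have "F\<^sub>2 (mul a (a, 1, 0) (x, y, z)) - F\<^sub>1 (x, y, z) = y"
      by (simp add: algebra_simps power2_eq_square)
    then have 1: "0 \<le> y" using min2[OF pos_unit_rho_plus_a(1)] by linarith
    have "F\<^sub>2 (mul a (a\<^sup>2 + a - 1, - a\<^sup>2 + a + 1, - a) (x, y, z)) - F\<^sub>1 (x, y, z) = (a - 1) * (a * x - y)"
      by (simp add: algebra_simps power2_eq_square)
    then have "0 \<le> (a - 1) * (a * x - y)" using min2[OF pos_unit_rho2(2)] by linarith
    then have 2: "y \<le> a * x" using a3 by (simp add: zero_le_mult_iff)
    have "F\<^sub>2 (x, y, z) - F\<^sub>1 (x, y, z) = (a * a - a - 1) * (a * z - y)"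
      by (simp add: algebra_simps power2_eq_square)
    then have "0 \<le> (a * a - a - 1) * (a * z - y)" using min2[OF pos_unit_one, unfolded mul_one] by linarith
    then have 3: "y \<le> a * z" using aa by (simp add: zero_le_mult_iff)
    have "F\<^sub>1 (x, y, z) \<le> F\<^sub>1 t" using undo[OF first(1)] min1 s by metis
    then show ?thesis using that(1)[OF first(1) s] pos_mul[OF first(1) assms] s 1 2 3 by simp
  next
    case (second u)
    obtain x y z where s: "mul a u t = (x, y, z)" by (metis surj_pair)
    note min1 = second(2)[unfolded s] and min2 = second(3)[unfolded s]
    have "F\<^sub>1 (mul a (0, 0, 1) (x, y, z)) - F\<^sub>2 (x, y, z) = (a - 1) * z"
      by (simp add: algebra_simps power2_eq_square)
    then have "0 \<le> (a - 1) * z" using min1[OF pos_unit_rho2(1)] by linarith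
    then have 1: "0 \<le> z" using a3 by (simp add: zero_le_mult_iff)
    have "F\<^sub>1 (mul a (0, -1, 1) (x, y, z)) - F\<^sub>2 (x, y, z) = x - (a * (y - a * z) + z)"
      by (simp add: algebra_simps power2_eq_square)
    then have 2: "a * (y - a * z) + z \<le> x" using min1[OF pos_unit_rho_plus_a(2)] by linarith
    have "F\<^sub>1 (x, y, z) - F\<^sub>2 (x, y, z) = (a * a - a - 1) * (y - a * z)"
      by (simp add: algebra_simps power2_eq_square)
    then have "0 \<le> (a * a - a - 1) * (y - a * z)" using min1[OF pos_unit_one, unfolded mul_one] by linarith
    then have 3: "a * z \<le> y" using aa by (simp add: zero_le_mult_iff)
    have "F\<^sub>2 (x, y, z) \<le> F\<^sub>1 t" using undo[OF second(1)] min1 s by metis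
    then show ?thesis using that(2)[OF second(1) s] pos_mul[OF second(1) assms] s 1 2 3 by simp
  qed
qed

text \<open>Improves positivity to the bound needed for indecomposability: on the first cone the
  value is either a multiple of \<open>a\<close> or at least \<open>a * x\<close> with
  \<open>x\<close> positive.\<close>

lemma F1_lower_bound:
  assumes "pos t"
  shows "a \<le> F\<^sub>1 t"
  using assms
proof (cases rule: pos_reduction)
  case (first u x y z)
  have "a \<le> F\<^sub>1 (x, y, z)"
  proof (cases "y = 0")
    case True
    have "0 < a * (x + z)" using F1_pos[OF first(3)] True by (simp add: algebra_simps)
    then have "1 \<le> x + z" using a3 by (simp add: zero_less_mult_iff)
    then have "a * 1 \<le> a * (x + z)" using a3 by (intro mult_left_mono) auto
    then show ?thesis using True by (simp add: algebra_simps)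
  next
    case False
    then have "0 < a * x" using first by linarith
    then have "1 \<le> x" using a3 by (simp add: zero_less_mult_iff)
    then have "a * 1 \<le> a * x" using a3 by (intro mult_left_mono) auto
    then show ?thesis using first by simp
  qed
  then show ?thesis using first by linarith
next
  case (second u x y z)
  then show ?thesis using F2_lower_bound by (meson order_trans)
qed

text \<open>
  Coordinates with respect to the basis \<open>1\<close>, \<open>\<rho>\<^sup>2 - \<rho>\<close>, \<open>\<rho>\<^sup>2\<close> are \<open>(- v, A, n)\<close>, so \<open>n = H / 2\<close>;
  the shear \<open>A = W + a (v - n)\<close> straightens the pentagon. The parameters of the third listed family
  are \<open>v\<close> and \<open>w = W\<close> at height \<open>n = 1\<close>.
\<close>

lemma mix_reduction:
  assumes "mix t"
  obtains (first) u v W n where "pos_unit u" "mul a u t = (- v, - (W + a * (v - n)), W + a * (v - n) + n)"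
      "0 < n" "n \<le> v" "0 \<le> W" "v - 2 * n \<le> W" "W \<le> (a - 1) * n" "v + W \<le> (2 * a - 2) * n"
      "2 * n \<le> G t"
    | (second) u v A n where "pos_unit u" "mul a u t = (- v, - A, A + n)"
      "0 < n" "v \<le> n" "v \<le> 2 * A + n" "2 * A + n - v \<le> 2 * (a - 1) * v" "v + n \<le> G t"
proof -
  have undo: "\<exists>w. pos_unit w \<and> mul a w (mul a u t) = t" if u: "pos_unit u" for u
    using pos_unit_inverse[OF u] by (metis mul_assoc mul_one)
  have "\<forall>u. pos_unit u \<longrightarrow> 0 \<le> H (mul a u t)" "\<forall>u. pos_unit u \<longrightarrow> 0 \<le> G (mul a u t)"
    using H_lower_bound[OF mix_mul[OF _ assms]] G_pos[OF mix_mul[OF _ assms]]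
    by (force intro: less_imp_le)+
  then show ?thesis
  proof (cases rule: orbit_minimum[of H t G])
    case (first u)
    obtain x y z where xyz: "mul a u t = (x, y, z)" by (metis surj_pair)
    define v n W where "v = - x" and "n = y + z" and "W = - y - a * (v - n)"
    have s: "mul a u t = (- v, - (W + a * (v - n)), W + a * (v - n) + n)"
      by (simp add: xyz v_def n_def W_def)
    let ?s = "(- v, - (W + a * (v - n)), W + a * (v - n) + n)"
    note min1 = first(2)[unfolded s] and min2 = first(3)[unfolded s]
    have n: "0 < n" using H_lower_bound[OF mix_mul[OF first(1) assms]] s by simp
    \<comment> \<open>The five competitors used from here on yield the five sides of the
      pentagon.\<close>
    have 1: "n \<le> v" using min2[OF pos_unit_one, unfolded mul_one] by simp
    have "G (mul a (1, a, 1) ?s) - H ?s = W"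
      by (simp add: algebra_simps power2_eq_square)
    then have 2: "0 \<le> W" using min2[OF pos_unit_rho2_times_rho_plus_a(1)] by linarith
    have "H (mul a (1, a, 1) ?s) - H ?s = 2 * (W - v + 2 * n)"
      by (simp add: algebra_simps power2_eq_square)
    then have "0 \<le> 2 * (W - v + 2 * n)" using min1[OF pos_unit_rho2_times_rho_plus_a(1)] by (metis diff_ge_0_iff_ge)
    then have 3: "v - 2 * n \<le> W" by simp
    have "H (mul a (a + 1, 1 - a, -1) ?s) - H ?s = 2 * ((a - 1) * n - W)"
      by (simp add: algebra_simps power2_eq_square)
    then have "0 \<le> 2 * ((a - 1) * n - W)" using min1[OF pos_unit_rho2_times_rho_plus_a(2)] by (metis diff_ge_0_iff_ge)
    then have 4: "W \<le> (a - 1) * n" by simp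
    have "G (mul a (a, 1, 0) ?s) - H ?s = (2 * a - 2) * n - (v + W)"
      by (simp add: algebra_simps power2_eq_square)
    then have 5: "v + W \<le> (2 * a - 2) * n" using min2[OF pos_unit_rho_plus_a(1)] by linarith
    have "H ?s \<le> G t" using undo[OF first(1)] min2 s by metis
    then have 6: "2 * n \<le> G t" by simp
    show ?thesis using that(1)[OF first(1) s n 1 2 3 4 5 6] .
  next
    case (second u)
    obtain x y z where xyz: "mul a u t = (x, y, z)" by (metis surj_pair)
    define v n A where "v = - x" and "n = y + z" and "A = - y"
    have s: "mul a u t = (- v, - A, A + n)"
      by (simp add: xyz v_def n_def A_def)
    let ?s = "(- v, - A, A + n)"
    note min1 = second(2)[unfolded s] and min2 = second(3)[unfolded s]
    have n: "0 < n" using H_lower_bound[OF mix_mul[OF second(1) assms]] s by simp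
    have 1: "v \<le> n" using min1[OF pos_unit_one, unfolded mul_one] by simp
    have "H (mul a (0, -1, 1) ?s) - G ?s = 2 * A + n - v"
      by (simp add: algebra_simps power2_eq_square)
    then have 2: "v \<le> 2 * A + n" using min1[OF pos_unit_rho_plus_a(2)] by linarith
    have "H (mul a (a + 1, 1 - a, -1) ?s) - G ?s = 2 * (a - 1) * v - (2 * A + n - v)"
      by (simp add: algebra_simps power2_eq_square)
    then have 3: "2 * A + n - v \<le> 2 * (a - 1) * v" using min1[OF pos_unit_rho2_times_rho_plus_a(2)] by linarith
    have "G ?s \<le> G t" using undo[OF second(1)] min2 s by metis
    then have 4: "v + n \<le> G t" by simp
    show ?thesis using that(2)[OF second(1) s n 1 2 3 4] .
  qed
qed

text \<open>In the triangle case the value 1 would need \<open>v = 0\<close> and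
  \<open>n = 1\<close>, hence \<open>2 * A + 1 = 0\<close>, which parity forbids.\<close>

lemma G_lower_bound:
  assumes "mix t"
  shows "2 \<le> G t"
  using assms
proof (cases rule: mix_reduction)
  case (first u v W n)
  then show ?thesis by linarith
next
  case (second u v A n)
  have "0 \<le> (a - 1) * v" using second by linarith
  then have "0 \<le> v" using a3 by (simp add: zero_le_mult_iff)
  moreover have "\<not> (v = 0 \<and> n = 1)"
  proof
    assume "v = 0 \<and> n = 1"
    then have "0 \<le> 2 * A + 1" "2 * A + 1 \<le> 0" using second by auto
    then show False by presburger
  qed
  ultimately show ?thesis using second by linarith
qed

section \<open>The cones lie in the octants\<close>

lemma conic_combination_pos:
  fixes e p q s :: real and i j k m :: int
  assumes "of_int m * e = of_int i * p + of_int j * q + of_int k * s"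
    and "0 < m" "0 \<le> i" "0 \<le> j" "0 \<le> k" "i \<noteq> 0 \<or> j \<noteq> 0 \<or> k \<noteq> 0" "0 < p" "0 < q" "0 < s"
  shows "0 < e"
proof -
  have "0 \<le> of_int i * p" "0 \<le> of_int j * q" "0 \<le> of_int k * s"
    using assms by auto
  moreover have "0 < of_int i * p \<or> 0 < of_int j * q \<or> 0 < of_int k * s"
    using assms by auto
  ultimately have "0 < of_int m * e" unfolding assms(1) by linarith
  then show ?thesis using assms(2) by (simp add: zero_less_mult_iff)
qed

lemma pos_conic_combination:
  assumes "\<And>r. of_int m * ev r t = of_int i * ev r p + of_int j * ev r q + of_int k * ev r s"
    and "0 < m" "0 \<le> i" "0 \<le> j" "0 \<le> k" "i \<noteq> 0 \<or> j \<noteq> 0 \<or> k \<noteq> 0" "pos p" "pos q" "pos s"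
  shows "pos t"
  using assms(7-9) conic_combination_pos[OF assms(1-6)] unfolding pos_def by blast

lemma mix_conic_combination:
  assumes c: "\<And>r. of_int m * ev r t = of_int i * ev r p + of_int j * ev r q + of_int k * ev r s"
    and "0 < m" "0 \<le> i" "0 \<le> j" "0 \<le> k" "i \<noteq> 0 \<or> j \<noteq> 0 \<or> k \<noteq> 0" "mix p" "mix q" "mix s"
  shows "mix t"
proof -
  have "of_int m * (- ev r t) = of_int i * (- ev r p) + of_int j * (- ev r q) + of_int k * (- ev r s)" for r
    using c[of r] by simp
  from conic_combination_pos[OF this assms(2-6)] have "0 < - ev r\<^sub>2 t"
    using assms(7-9) unfolding mix_def by simp
  then show ?thesis
    using assms(7-9) conic_combination_pos[OF assms(1-6)] unfolding mix_def by auto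
qed

lemmas pos_vertices = pos_unit_one[unfolded pos_unit_def, THEN conjunct1]
  pos_unit_rho2(1)[unfolded pos_unit_def, THEN conjunct1]
  pos_unit_rho_plus_a(1)[unfolded pos_unit_def, THEN conjunct1]
  pos_unit_rho2_times_rho_plus_a(1)[unfolded pos_unit_def, THEN conjunct1]

text \<open>Converse of the reduction, certifying that what remains after a splitting is still in
  the octant. The coordinates relative to the vertices have denominator \<open>a\<close>.\<close>

lemma cone_F1_pos:
  assumes "0 \<le> y" "y \<le> a * x" "y \<le> a * z" "x \<noteq> 0 \<or> y \<noteq> 0 \<or> z \<noteq> 0"
  shows "pos (x, y, z)"
proof (rule pos_conic_combination[OF _ _ _ _ _ _ pos_vertices(1,2,4)])
  show "of_int a * ev r (x, y, z) = of_int (a * x - y) * ev r (1, 0, 0) +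
      of_int (a * z - y) * ev r (0, 0, 1) + of_int y * ev r (1, a, 1)" for r
    by (simp add: algebra_simps)
qed (use assms a3 in auto)

lemma cone_F2_pos:
  assumes "0 \<le> z" "a * z \<le> y" "a * (y - a * z) + z \<le> x" "x \<noteq> 0 \<or> y \<noteq> 0 \<or> z \<noteq> 0"
  shows "pos (x, y, z)"
proof (rule pos_conic_combination[OF _ _ _ _ _ _ pos_vertices(1,3,4)])
  show "of_int 1 * ev r (x, y, z) = of_int (x - a * (y - a * z) - z) * ev r (1, 0, 0) +
      of_int (y - a * z) * ev r (a, 1, 0) + of_int z * ev r (1, a, 1)" for r
    by (simp add: algebra_simps)
qed (use assms in auto)

text \<open>A pentagon gives no simplicial cone. Instead, the element is multiplied by \<rho> + a,
  and its value at each root becomes a combination of the side inequalities with a strict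
  remainder.\<close>

lemma cone_H_mix:
  assumes "0 < n" "n \<le> v" "0 \<le> W" "v - 2 * n \<le> W" "W \<le> (a - 1) * n" "v + W \<le> (2 * a - 2) * n"
  shows "mix (- v, - (W + a * (v - n)), W + a * (v - n) + n)"
proof -
  define A V n' W' where "A = real_of_int a" and "V = real_of_int v" and "n' = real_of_int n"
    and "W' = real_of_int W"
  note defs = A_def V_def n'_def W'_def
  let ?t = "(- v, - (W + a * (v - n)), W + a * (v - n) + n)"
  have ineqs: "0 < n'" "n' \<le> V" "0 \<le> W'" "V - 2 * n' \<le> W'" "W' \<le> (A - 1) * n'"
    "V + W' \<le> (2 * A - 2) * n'"
  proof -
    have "real_of_int (v - 2 * n) \<le> real_of_int W" "real_of_int W \<le> real_of_int ((a - 1) * n)"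
      "real_of_int (v + W) \<le> real_of_int ((2 * a - 2) * n)"
      using assms by (simp_all only: of_int_le_iff)
    then show "0 < n'" "n' \<le> V" "0 \<le> W'" "V - 2 * n' \<le> W'" "W' \<le> (A - 1) * n'"
      "V + W' \<le> (2 * A - 2) * n'" using assms by (simp_all add: defs)
  qed
  define X where "X = (\<lambda>r. W' - V * r + n' * (1 + A * r + r\<^sup>2 - A))"
  have X: "(r + A) * ev r ?t = X r" if r: "poly (cubic a) r = 0" for r
  proof -
    have "(r + A) * ev r ?t
        = - V * (r + A) + (W' + A * (V - n')) * (r * (r - 1) * (r + A)) + n' * (r ^ 3 + A * r\<^sup>2)"
      by (simp add: defs algebra_simps power2_eq_square power3_eq_cube)
    also have "r * (r - 1) * (r + A) = 1" using unit_inverse[OF r] by (simp add: A_def)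
    also have "r ^ 3 + A * r\<^sup>2 = 1 + A * r + r\<^sup>2" using cube[OF r] by (simp add: A_def algebra_simps)
    finally show ?thesis by (simp add: X_def algebra_simps)
  qed
  have "0 < X r\<^sub>1"
  proof -
    have "2 * V \<le> 2 * A * n'" using ineqs by (simp add: algebra_simps)
    then have "(A * n') * (1 - r\<^sub>1) \<le> V * (1 - r\<^sub>1)" using r1 by (intro mult_right_mono_neg) auto
    moreover have "0 < n' * (r\<^sub>1\<^sup>2 - 1)" using ineqs(1) r1 by (simp add: power2_eq_square less_1_mult)
    moreover have "X r\<^sub>1 = (W' - (V - 2 * n')) + (V * (1 - r\<^sub>1) - (A * n') * (1 - r\<^sub>1)) + n' * (r\<^sub>1\<^sup>2 - 1)"
      by (simp add: X_def algebra_simps)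
    ultimately show ?thesis using ineqs(4) by linarith
  qed
  moreover have "X r\<^sub>2 < 0"
  proof -
    have "(1 + r\<^sub>2) * W' \<le> (1 + r\<^sub>2) * ((A - 1) * n')"
      using r2 ineqs by (intro mult_left_mono) auto
    moreover have "(- r\<^sub>2) * (V + W') \<le> (- r\<^sub>2) * ((2 * A - 2) * n')"
      using r2 ineqs by (intro mult_left_mono) auto
    moreover have "0 < n' * ((- r\<^sub>2) * (1 + r\<^sub>2))" using ineqs(1) r2 by (intro mult_pos_pos) auto
    moreover have "X r\<^sub>2 = ((1 + r\<^sub>2) * W' - (1 + r\<^sub>2) * ((A - 1) * n'))
        + ((- r\<^sub>2) * (V + W') - (- r\<^sub>2) * ((2 * A - 2) * n')) - n' * ((- r\<^sub>2) * (1 + r\<^sub>2))"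
      by (simp add: X_def algebra_simps power2_eq_square)
    ultimately show ?thesis by linarith
  qed
  moreover have "0 < X r\<^sub>3"
  proof -
    have "n' * (- r\<^sub>3) \<le> V * (- r\<^sub>3)" using r3 ineqs by (intro mult_right_mono) auto
    moreover have "0 < n' * (1 + A * r\<^sub>3 + r\<^sub>3\<^sup>2 - A - r\<^sub>3)"
    proof -
      have "(- r\<^sub>3) * (1 + A * r\<^sub>3 + r\<^sub>3\<^sup>2 - A - r\<^sub>3) = - 1 - r\<^sub>3"
        using cube3 by (simp add: A_def algebra_simps power2_eq_square power3_eq_cube)
      then have "0 < (- r\<^sub>3) * (1 + A * r\<^sub>3 + r\<^sub>3\<^sup>2 - A - r\<^sub>3)" using r3 by simp
      then have "0 < 1 + A * r\<^sub>3 + r\<^sub>3\<^sup>2 - A - r\<^sub>3" by (rule zero_less_mult_pos) (use r3 in simp)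
      then show ?thesis using ineqs(1) by simp
    qed
    moreover have "X r\<^sub>3 = W' + (V * (- r\<^sub>3) - n' * (- r\<^sub>3)) + n' * (1 + A * r\<^sub>3 + r\<^sub>3\<^sup>2 - A - r\<^sub>3)"
      by (simp add: X_def algebra_simps)
    ultimately show ?thesis using ineqs(3) by linarith
  qed
  moreover have "0 < r\<^sub>1 + A" "0 < r\<^sub>2 + A" "0 < r\<^sub>3 + A"
    using r1 r2 r3_bound a3' by (auto simp: A_def)
  ultimately show ?thesis
    unfolding mix_def X[OF root1, symmetric] X[OF root2, symmetric] X[OF root3, symmetric]
    by (simp only: zero_less_mult_iff mult_less_0_iff) auto
qed

lemma mix_rho_plus_rho2: "mix (0, 1, 1)"
proof -
  have "0 < r\<^sub>1 * (1 + r\<^sub>1)" "r\<^sub>2 * (1 + r\<^sub>2) < 0" "0 < r\<^sub>3 * (1 + r\<^sub>3)"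
    using r1 r2 r3 by (auto intro: mult_neg_pos mult_neg_neg)
  then show ?thesis unfolding mix_def by (simp add: algebra_simps power2_eq_square)
qed

text \<open>Coordinates relative to the vertices of the triangle, with denominator
  \<open>2 * (a - 1)\<close>. Two vertices also belong to the pentagon.\<close>

lemma cone_G_mix:
  assumes "0 < n" "v \<le> n" "v \<le> 2 * A + n" "2 * A + n - v \<le> 2 * (a - 1) * v"
  shows "mix (- v, - A, A + n)"
proof (rule mix_conic_combination[OF _ _ _ _ _ _ _ _ mix_rho_plus_rho2])
  show "of_int (2 * (a - 1)) * ev r (- v, - A, A + n) =
      of_int (2 * (a - 1) * v - (2 * A + n - v)) * ev r (- 1, 0, 1)
    + of_int (2 * A + n - v) * ev r (- 1, 1 - a, a) + of_int ((a - 1) * (n - v)) * ev r (0, 1, 1)" for r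
    by (simp add: algebra_simps)
  show "mix (- 1, 0, 1)" using cone_H_mix[of 1 1 0] a3 by simp
  show "mix (- 1, 1 - a, a)" using cone_H_mix[of 1 1 "a - 1"] a3 by simp
  show "2 * (a - 1) * v - (2 * A + n - v) \<noteq> 0 \<or> 2 * A + n - v \<noteq> 0 \<or> (a - 1) * (n - v) \<noteq> 0"
  proof (rule ccontr)
    assume "\<not> ?thesis"
    then have "v = n" "(a - 1) * v = 0" using a3 by auto
    then show False using assms(1) a3 by simp
  qed
  show "0 \<le> (a - 1) * (n - v)" using assms a3 by simp
qed (use assms a3 in auto)

section \<open>Splitting off listed elements\<close>

lemma decomposable_posI: "pos b \<Longrightarrow> pos c \<Longrightarrow> t = b + c \<Longrightarrow> decomposable t"
  unfolding decomposable_def same_signs_def pos_def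
  by (rule exI[of _ b], rule exI[of _ c]) (auto simp: ev_add)

lemma decomposable_mixI: "mix b \<Longrightarrow> mix c \<Longrightarrow> t = b + c \<Longrightarrow> decomposable t"
  unfolding decomposable_def same_signs_def mix_def
  by (rule exI[of _ b], rule exI[of _ c]) (auto simp: ev_add)

definition listed :: "triple set" where
  "listed = {(1, 0, 0)} \<union> {(1, s, 1) | s. 1 \<le> s \<and> s \<le> a - 1}
    \<union> {(- v, - (a * (v - 1) + w), a * (v - 1) + w + 1) | v w.
         1 \<le> v \<and> v \<le> a - 1 \<and> max 1 (v - 1) \<le> w \<and> w \<le> a - 1}
    \<union> {(- 1, - u, u + 2) | u. 0 \<le> u \<and> u \<le> a - 2}"

text \<open>A property invariant under units, so that one representative of each orbit
  suffices.\<close>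

definition classified :: "triple \<Rightarrow> bool" where
  "classified t \<longleftrightarrow> decomposable t \<or> (\<exists>u. invertible u \<and> mul a u t \<in> listed)"

lemma classifiedI_listed: "t \<in> listed \<Longrightarrow> classified t"
  unfolding classified_def
  by (rule disjI2, rule exI[of _ "(1, 0, 0)"]) (use pos_unit_one in \<open>auto simp: mul_one pos_unit_def\<close>)

lemma classifiedI_unit: "pos_unit u \<Longrightarrow> mul a u t \<in> listed \<Longrightarrow> classified t"
  unfolding classified_def pos_unit_def by blast

lemma classified_mul: "invertible u \<Longrightarrow> classified (mul a u t) \<Longrightarrow> classified t"
  unfolding classified_def using decomposable_mul invertible_mul by (metis mul_assoc)

lemma one_listed: "(1, 0, 0) \<in> listed"
  by (simp add: listed_def)

lemma pos_classified:
  assumes "pos t"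
  shows "classified t"
  using assms
proof (cases rule: pos_reduction)
  case (first u x y z)
  have "classified (x, y, z)"
  proof (cases "y = 0")
    case True
    then have xz: "0 \<le> x" "0 \<le> z" using first a3 by (auto simp: zero_le_mult_iff)
    consider "x = 0" "z \<le> 1" | "x = 0" "2 \<le> z" | "x = 1" "z = 0" | "1 \<le> x" "x \<noteq> 1 \<or> z \<noteq> 0"
      using xz by linarith
    then show ?thesis
    proof cases
      case 1
      then have "z = 1" using F1_pos[OF first(3)] True xz by (cases "z = 0") auto
      then have "mul a (a\<^sup>2 + a - 1, - a\<^sup>2 + a + 1, - a) (x, y, z) = (1, 0, 0)"
        using 1 True by (simp add: algebra_simps power2_eq_square)
      then show ?thesis using classifiedI_unit[OF pos_unit_rho2(2)] one_listed by simp
    next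
      case 2
      then have "pos (0, 0, z - 1)" using a3 by (intro cone_F1_pos) auto
      then show ?thesis unfolding classified_def
        by (intro disjI1 decomposable_posI[OF pos_vertices(2)]) (use 2 True in auto)
    next
      case 3
      then show ?thesis using classifiedI_listed[OF one_listed] True by simp
    next
      case 4
      then have "pos (x - 1, 0, z)" using a3 xz by (intro cone_F1_pos) auto
      then show ?thesis unfolding classified_def
        by (intro disjI1 decomposable_posI[OF pos_vertices(1)]) (use True in auto)
    qed
  next
    case False
    then have "0 < a * x" "0 < a * z" using first by linarith+
    then have xz: "1 \<le> x" "1 \<le> z" using a3 by (auto simp: zero_less_mult_iff)
    \<comment> \<open>The cap \<open>a\<close> keeps 1 + s\<rho> + \<rho>^2 in the cone. At
      \<open>s = a\<close> it is the unit \<rho>^2(\<rho> + a); below that it belongs to the second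
      family.\<close>
    define s where "s = min y a"
    have s: "1 \<le> s" "s \<le> a" "s \<le> y" using False first a3 by (auto simp: s_def)
    have ps: "pos (1, s, 1)" using s a3 by (intro cone_F1_pos) auto
    show ?thesis
    proof (cases "x = 1 \<and> y = s \<and> z = 1")
      case True
      show ?thesis
      proof (cases "s = a")
        case True
        then have "mul a (a + 1, 1 - a, -1) (x, y, z) = (1, 0, 0)"
          using \<open>x = 1 \<and> y = s \<and> z = 1\<close> by (simp add: algebra_simps power2_eq_square)
        then show ?thesis using classifiedI_unit[OF pos_unit_rho2_times_rho_plus_a(2)] one_listed by simp
      next
        case False
        then have "(x, y, z) \<in> listed" using s True by (auto simp: listed_def)
        then show ?thesis by (rule classifiedI_listed)
      qed
    next
      case False
      have "y - s \<le> a * (x - 1)" "y - s \<le> a * (z - 1)"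
      proof -
        have "0 \<le> a * (x - 1)" "0 \<le> a * (z - 1)" using a3 xz by auto
        then show "y - s \<le> a * (x - 1)" "y - s \<le> a * (z - 1)"
          using first by (auto simp: s_def min_def algebra_simps)
      qed
      then have "pos (x - 1, y - s, z - 1)" using s False by (intro cone_F1_pos) auto
      then show ?thesis unfolding classified_def
        by (intro disjI1 decomposable_posI[OF ps]) auto
    qed
  qed
  then show ?thesis using first classified_mul unfolding pos_unit_def by metis
next
  case (second u x y z)
  have nz: "x \<noteq> 0 \<or> y \<noteq> 0 \<or> z \<noteq> 0" using second(3) by (auto simp: pos_def)
  have "classified (x, y, z)"
  \<comment> \<open>The vertices of this facet form a lattice basis and are units, so a vertex can
    be split off until only one is left.\<close>
  proof (cases "z = 0")
    case False
    then have z: "1 \<le> z" using second by simp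
    show ?thesis
    proof (cases "x = 1 \<and> y = a \<and> z = 1")
      case True
      then have "mul a (a + 1, 1 - a, -1) (x, y, z) = (1, 0, 0)"
        by (simp add: algebra_simps power2_eq_square)
      then show ?thesis using classifiedI_unit[OF pos_unit_rho2_times_rho_plus_a(2)] one_listed by simp
    next
      case False
      then have "pos (x - 1, y - a, z - 1)" using z second
        by (intro cone_F2_pos) (auto simp: algebra_simps)
      then show ?thesis unfolding classified_def
        by (intro disjI1 decomposable_posI[OF pos_vertices(4)]) auto
    qed
  next
    case z: True
    show ?thesis
    proof (cases "y = 0")
      case y: True
      then have x: "1 \<le> x" using second z nz by auto
      show ?thesis
      proof (cases "x = 1")
        case True
        then show ?thesis using classifiedI_listed[OF one_listed] y z by simp
      next
        case False
        then have "pos (x - 1, 0, 0)" using x by (intro cone_F2_pos) auto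
        then show ?thesis unfolding classified_def
          by (intro disjI1 decomposable_posI[OF pos_vertices(1)]) (use y z in auto)
      qed
    next
      case False
      then have y: "1 \<le> y" using second z by auto
      show ?thesis
      proof (cases "x = a \<and> y = 1")
        case True
        then have "mul a (0, -1, 1) (x, y, z) = (1, 0, 0)"
          using z by (simp add: algebra_simps power2_eq_square)
        then show ?thesis using classifiedI_unit[OF pos_unit_rho_plus_a(2)] one_listed by simp
      next
        case False
        then have "pos (x - a, y - 1, 0)" using y z second
          by (intro cone_F2_pos) (auto simp: algebra_simps)
        then show ?thesis unfolding classified_def
          by (intro disjI1 decomposable_posI[OF pos_vertices(3)]) (use z in auto)
      qed
    qed
  qed
  then show ?thesis using second classified_mul unfolding pos_unit_def by metis
qed

section \<open>Splitting over the pentagon and the triangle\<close>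

lemma listed_P:
  "1 \<le> v \<Longrightarrow> v \<le> a - 1 \<Longrightarrow> 1 \<le> w \<Longrightarrow> v - 1 \<le> w \<Longrightarrow> w \<le> a - 1 \<Longrightarrow>
    (- v, - (a * (v - 1) + w), a * (v - 1) + w + 1) \<in> listed"
  unfolding listed_def by auto

lemma cone_H_classified:
  assumes n: "0 < n" and c: "n \<le> v" "0 \<le> W" "v - 2 * n \<le> W" "W \<le> (a - 1) * n" "v + W \<le> (2 * a - 2) * n"
  shows "classified (- v, - (W + a * (v - n)), W + a * (v - n) + n)" (is "classified ?t")
proof (cases "n = 1")
  case True
  \<comment> \<open>Only the side \<open>W = v - 2\<close> and the vertex \<rho>^2 - 1 lie outside
    the third family; \<rho>^2(\<rho> + a) and \<rho>^2 move them into it.\<close>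
  consider "1 \<le> W" "v - 1 \<le> W" | "W = v - 2" | "v = 1" "W = 0"
    using c True by linarith
  then show ?thesis
  proof cases
    case 1
    then have "?t \<in> listed" using listed_P[of v W] c True by (simp add: algebra_simps)
    then show ?thesis by (rule classifiedI_listed)
  next
    case 2
    have "mul a (1, a, 1) ?t = (- (v - 1), - (a * ((v - 1) - 1) + (a - 1)), a * ((v - 1) - 1) + (a - 1) + 1)"
      unfolding 2 True by (simp add: algebra_simps power2_eq_square)
    moreover have "\<dots> \<in> listed" using c 2 True a3 by (intro listed_P) auto
    ultimately show ?thesis using classifiedI_unit[OF pos_unit_rho2_times_rho_plus_a(1)] by (simp only:)
  next
    case 3
    have "mul a (0, 0, 1) ?t = (- (a - 1), - (a * ((a - 1) - 1) + (a - 1)), a * ((a - 1) - 1) + (a - 1) + 1)"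
      unfolding 3 True by (simp add: algebra_simps power2_eq_square)
    moreover have "\<dots> \<in> listed" using a3 by (intro listed_P) auto
    ultimately show ?thesis using classifiedI_unit[OF pos_unit_rho2(1)] by (simp only:)
  qed
next
  case False
  then have n2: "2 \<le> n" using n by simp
  \<comment> \<open>At height \<open>1\<close> the cone is a polygon whose column over each integer \<open>v\<close> is an interval of \<open>W\<close> with
    integral ends, and all breaks of these ends are at integers. Hence \<open>(v, W, n)\<close> is a sum of
    \<open>n\<close> lattice points of the polygon from the columns \<open>v div n\<close> and \<open>v div n + 1\<close>.\<close>
  define q where "q = v div n"
  have q: "q * n \<le> v" "v \<le> q * n + n - 1"
    using div_mult_mod_eq[of v n] pos_mod_bound[OF n, of v] pos_mod_sign[OF n, of v]
    unfolding q_def by linarith+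
  have va: "v \<le> a * n" using c by (simp add: algebra_simps)
  have "0 < q" using n c(1) unfolding q_def by (simp add: pos_imp_zdiv_pos_iff)
  then have q1: "1 \<le> q" by simp
  have qa: "q \<le> a"
  proof (rule ccontr)
    assume "\<not> q \<le> a"
    then have "(a + 1) * n \<le> q * n" using n by (intro mult_right_mono) auto
    then show False using q va n by (simp add: algebra_simps)
  qed
  \<comment> \<open>\<open>A\<close> keeps the remainder within the last column \<open>a\<close>;
    \<open>B\<close>, \<open>C\<close> handle the break of the lower ends at column 2, and
    \<open>D\<close>, \<open>E\<close> that of the upper ends at column
    \<open>a - 1\<close>.\<close>
  have A: "v - q \<le> a * (n - 1)"
  proof (cases "q = a")
    case True
    then show ?thesis using va by (simp add: algebra_simps)
  next
    case False
    then have "(q + 1) * (n - 1) \<le> a * (n - 1)" using qa n by (intro mult_right_mono) auto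
    then show ?thesis using q by (simp add: algebra_simps)
  qed
  have B: "v \<le> 2 * n - 1" if "q \<le> 1"
    using q q1 that by simp
  have C: "q - 2 \<le> v - 2 * n" if "2 \<le> q"
  proof -
    have "0 \<le> (q - 2) * (n - 1)" using that n by auto
    then show ?thesis using q by (simp add: algebra_simps)
  qed
  have D: "a * n \<le> v" if "q = a"
    using q that by simp
  have E: "v \<le> (a - 1) * n - (a - 1) + q" if "q \<le> a - 2"
  proof -
    have "0 \<le> (a - 2 - q) * (n - 1)" using that n by auto
    then show ?thesis using q by (simp add: algebra_simps)
  qed
  have Q: "n - 1 \<le> v - q"
  proof -
    have "0 \<le> (q - 1) * (n - 1)" using q1 n by auto
    then show ?thesis using q by (simp add: algebra_simps)
  qed
  have N: "0 \<le> (a - 2) * (n - 1)" using a3 n by auto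
  \<comment> \<open>The least \<open>w\<close> allowed by the lower sides for the piece
    \<open>(q, w, 1)\<close> and the upper sides for the remainder. The other sides bound
    \<open>w\<close> from above and are compared with each of the four lower bounds.\<close>
  define w where "w = max (max 0 (q - 2)) (max (W - (a - 1) * (n - 1)) (W + (v - q) - (2 * a - 2) * (n - 1)))"
  have lower: "0 \<le> w" "q - 2 \<le> w" "W - w \<le> (a - 1) * (n - 1)" "v - q + (W - w) \<le> (2 * a - 2) * (n - 1)"
    unfolding w_def by linarith+
  have upper: "w \<le> m" if "0 \<le> m" "q - 2 \<le> m" "W - (a - 1) * (n - 1) \<le> m"
      "W + (v - q) - (2 * a - 2) * (n - 1) \<le> m" for m
    unfolding w_def using that by simp
  note arith = A B C D E N c q1 qa n2 a3
  have "W + (v - q) - (2 * a - 2) * (n - 1) \<le> a - 1"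
    by (cases "q \<le> a - 2") (use E c in \<open>simp_all add: algebra_simps\<close>)
  then have "w \<le> a - 1" using arith by (intro upper) (auto simp: algebra_simps)
  moreover have "W - (a - 1) * (n - 1) \<le> 2 * a - 2 - q"
    by (cases "q = a") (use D c qa n2 in \<open>simp_all add: algebra_simps\<close>)
  then have "w \<le> 2 * a - 2 - q" using arith by (intro upper) (auto simp: algebra_simps)
  moreover have "w \<le> W"
    by (cases "q \<le> 1"; intro upper) (use arith in \<open>simp_all add: algebra_simps\<close>)
  moreover have "w \<le> W - (v - q - 2 * (n - 1))"
    by (cases "q \<le> 1"; intro upper) (use arith in \<open>simp_all add: algebra_simps\<close>)
  ultimately have "mix (- q, - (w + a * (q - 1)), w + a * (q - 1) + 1)"
    "mix (- (v - q), - ((W - w) + a * ((v - q) - (n - 1))), (W - w) + a * ((v - q) - (n - 1)) + (n - 1))"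
    using lower Q n2 q1 by (intro cone_H_mix; simp)+
  then show ?thesis unfolding classified_def
    by (intro disjI1, elim decomposable_mixI) (auto simp: algebra_simps)
qed

text \<open>Over the triangle, \<open>n - v\<close> measures the distance from the edge shared with
  the pentagon: 0 on the edge, 1 on the fourth family, 2 at the vertex \<rho> + \<rho>^2. The latter
  is split off while \<open>n - v\<close> is at least 2.\<close>

lemma mix_classified:
  assumes "mix t"
  shows "classified t"
  using assms
proof (cases rule: mix_reduction)
  case (first u v W n)
  then show ?thesis using cone_H_classified[of n v W] classified_mul unfolding pos_unit_def by metis
next
  case (second u v A n)
  have "0 \<le> (a - 1) * v" using second by linarith
  then have v: "0 \<le> v" using a3 by (simp add: zero_le_mult_iff)
  have "classified (- v, - A, A + n)"
  proof -
    consider "n = v" | "n = v + 1" "v = 0" | "n = v + 1" "v = 1" | "n = v + 1" "2 \<le> v"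
      | "n = 2" "v = 0" | "v + 2 \<le> n" "3 \<le> n"
      using second v by linarith
    then show ?thesis
    proof cases
      case 1
      have "A \<le> (a - 1) * n" "n + A \<le> (2 * a - 2) * n"
      proof -
        have "1 * n \<le> (a - 1) * n" using a3 second by (intro mult_right_mono) auto
        moreover show "A \<le> (a - 1) * n" using second 1 by (simp add: algebra_simps)
        ultimately show "n + A \<le> (2 * a - 2) * n" by (simp add: algebra_simps)
      qed
      then show ?thesis using cone_H_classified[of n v A] second 1 by simp
    next
      case 2
      then have "0 \<le> 2 * A + 1" "2 * A + 1 \<le> 0" using second by auto
      then have False by presburger
      then show ?thesis ..
    next
      case 3
      then have "(- v, - A, A + n) \<in> listed" using second unfolding listed_def by auto
      then show ?thesis by (rule classifiedI_listed)
    next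
      case 4
      \<comment> \<open>A member of the fourth family is split off, leaving a remainder over the
        shared edge; capping at \<open>a - 2\<close> keeps both within their bounds.\<close>
      define w where "w = min A (a - 2)"
      have av: "0 \<le> (a - 1) * (v - 1)" using a3 4 by auto
      have A0: "0 \<le> A" using second 4 by linarith
      have w: "0 \<le> w" "w \<le> a - 2" "w \<le> A" using A0 a3 by (auto simp: w_def)
      have Av: "A \<le> (a - 1) * v - 1" using second 4 by (simp add: algebra_simps)
      have "mix (- 1, - w, w + 2)" using w a3 by (intro cone_G_mix) auto
      moreover have "mix (- (v - 1), - (A - w), (A - w) + (v - 1))"
        using A0 a3 4 av Av by (intro cone_G_mix) (auto simp: w_def min_def algebra_simps)
      ultimately show ?thesis unfolding classified_def
        by (intro disjI1, elim decomposable_mixI) (use 4 in auto)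
    next
      case 5
      then have "A = - 1" using second by auto
      then have "mul a (0, -1, 1) (- v, - A, A + n)
          = (- (a - 1), - (a * ((a - 1) - 1) + (a - 1)), a * ((a - 1) - 1) + (a - 1) + 1)"
        unfolding 5 by (simp add: algebra_simps power2_eq_square)
      moreover have "\<dots> \<in> listed" using a3 by (intro listed_P) auto
      ultimately show ?thesis using classifiedI_unit[OF pos_unit_rho_plus_a(2)] by (simp only:)
    next
      case 6
      have "mix (- v, - (A + 1), (A + 1) + (n - 2))"
        using 6 second by (intro cone_G_mix) auto
      then show ?thesis unfolding classified_def
        by (intro disjI1 decomposable_mixI[OF mix_rho_plus_rho2]) auto
    qed
  qed
  then show ?thesis using second classified_mul unfolding pos_unit_def by metis
qed

text \<open>Since \<rho> has signature +--, multiplication by it takes +-- to +++ and ++- to +-+; a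
  factor -1 handles a negative first sign.\<close>

lemma nonzero_classified:
  assumes "ev r\<^sub>1 t \<noteq> 0" "ev r\<^sub>2 t \<noteq> 0" "ev r\<^sub>3 t \<noteq> 0"
  shows "classified t"
proof -
  have rho: "invertible (0, 1, 0)" unfolding invertible_def
    by (rule exI[of _ "(- a, a - 1, 1)"]) simp
  have neg: "invertible (- 1, 0, 0)" unfolding invertible_def
    by (rule exI[of _ "(- 1, 0, 0)"]) simp
  have *: "classified t" if nz: "0 < ev r\<^sub>1 t" "ev r\<^sub>2 t \<noteq> 0" "ev r\<^sub>3 t \<noteq> 0" for t
  proof -
    have m: "ev r\<^sub>1 (mul a (0, 1, 0) t) = r\<^sub>1 * ev r\<^sub>1 t" "ev r\<^sub>2 (mul a (0, 1, 0) t) = r\<^sub>2 * ev r\<^sub>2 t"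
      "ev r\<^sub>3 (mul a (0, 1, 0) t) = r\<^sub>3 * ev r\<^sub>3 t"
      using ev_mul1 ev_mul2 ev_mul3 by simp_all
    consider "0 < ev r\<^sub>2 t" "0 < ev r\<^sub>3 t" | "ev r\<^sub>2 t < 0" "0 < ev r\<^sub>3 t"
      | "ev r\<^sub>2 t < 0" "ev r\<^sub>3 t < 0" | "0 < ev r\<^sub>2 t" "ev r\<^sub>3 t < 0"
      using nz(2,3) unfolding neq_iff by blast
    then show ?thesis
    proof cases
      case 1
      then show ?thesis using nz pos_classified unfolding pos_def by blast
    next
      case 2
      then show ?thesis using nz mix_classified unfolding mix_def by blast
    next
      case 3
      then have "pos (mul a (0, 1, 0) t)"
        unfolding pos_def m using nz r1 r2 r3 by (auto intro: mult_neg_neg)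
      then show ?thesis using pos_classified classified_mul[OF rho] by blast
    next
      case 4
      then have "mix (mul a (0, 1, 0) t)"
        unfolding mix_def m using nz r1 r2 r3 by (auto intro: mult_neg_neg mult_neg_pos)
      then show ?thesis using mix_classified classified_mul[OF rho] by blast
    qed
  qed
  show ?thesis
  proof (cases "0 < ev r\<^sub>1 t")
    case True
    then show ?thesis using * assms by blast
  next
    case False
    have "ev r\<^sub>1 (mul a (- 1, 0, 0) t) = - ev r\<^sub>1 t" "ev r\<^sub>2 (mul a (- 1, 0, 0) t) = - ev r\<^sub>2 t"
      "ev r\<^sub>3 (mul a (- 1, 0, 0) t) = - ev r\<^sub>3 t"
      using ev_mul1 ev_mul2 ev_mul3 by simp_all
    then have "classified (mul a (- 1, 0, 0) t)" using assms False by (intro *) auto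
    then show ?thesis by (rule classified_mul[OF neg])
  qed
qed

section \<open>Indecomposability of the listed elements\<close>

lemma indecomposable_posI:
  assumes "pos t" "F\<^sub>1 t < 2 * a"
  shows "\<not> decomposable t"
proof
  assume "decomposable t"
  then obtain b c where bc: "same_signs b t" "same_signs c t" "t = b + c"
    unfolding decomposable_def by blast
  have "pos b" "pos c"
    using bc(1,2) assms(1) unfolding same_signs_def pos_def by (metis sgn_1_pos sgn_pos)+
  then have "a \<le> F\<^sub>1 b" "a \<le> F\<^sub>1 c" using F1_lower_bound by blast+
  moreover have "F\<^sub>1 t = F\<^sub>1 b + F\<^sub>1 c"
    unfolding bc(3) by (cases b; cases c) (simp add: algebra_simps)
  ultimately show False using assms(2) by linarith
qed

text \<open>Both forms are additive and at least 2 on the octant, so a sum has value at least 4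
  under each.\<close>

lemma indecomposable_mixI:
  assumes "mix t" "H t \<le> 3 \<or> G t \<le> 3"
  shows "\<not> decomposable t"
proof
  assume "decomposable t"
  then obtain b c where bc: "same_signs b t" "same_signs c t" "t = b + c"
    unfolding decomposable_def by blast
  have "mix b" "mix c"
    using bc(1,2) assms(1) unfolding same_signs_def mix_def
    by (metis sgn_1_pos sgn_pos sgn_1_neg sgn_neg)+
  then have "2 \<le> H b" "2 \<le> H c" "2 \<le> G b" "2 \<le> G c"
    using H_lower_bound G_lower_bound by blast+
  moreover have "H t = H b + H c" "G t = G b + G c"
    unfolding bc(3) by (cases b; cases c; simp add: algebra_simps)+
  ultimately show False using assms(2) by linarith
qed

text \<open>The decisive values: \<open>F\<^sub>1\<close> is \<open>a\<close> at 1 and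
  \<open>2 * a - s\<close> on the second family, \<open>H\<close> is 2 on the third,
  \<open>G\<close> is 3 on the fourth.\<close>

lemma listed_indecomposable:
  assumes "t \<in> listed"
  shows "(pos t \<or> mix t) \<and> \<not> decomposable t"
proof -
  consider "t = (1, 0, 0)" | s where "t = (1, s, 1)" "1 \<le> s" "s \<le> a - 1"
    | v w where "t = (- v, - (a * (v - 1) + w), a * (v - 1) + w + 1)"
      "1 \<le> v" "v \<le> a - 1" "max 1 (v - 1) \<le> w" "w \<le> a - 1"
    | u where "t = (- 1, - u, u + 2)" "0 \<le> u" "u \<le> a - 2"
    using assms unfolding listed_def by blast
  then show ?thesis
  proof cases
    case 1
    then show ?thesis using pos_vertices(1) indecomposable_posI a3 by simp
  next
    case 2
    then have "pos t" using a3 by (simp add: cone_F1_pos)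
    then show ?thesis using 2 indecomposable_posI by simp
  next
    case 3
    have "mix (- v, - (w + a * (v - 1)), w + a * (v - 1) + 1)"
      using 3 by (intro cone_H_mix) auto
    then have "mix t" using 3(1) by (simp add: algebra_simps)
    then show ?thesis using 3(1) indecomposable_mixI by simp
  next
    case 4
    have "mix t" unfolding 4(1) using 4 a3 by (intro cone_G_mix) auto
    then show ?thesis using 4(1) indecomposable_mixI by simp
  qed
qed

end

section \<open>Transfer to the field\<close>

text \<open>Horner's scheme: each step multiplies by \<rho> and adds an integer, both available on
  triples.\<close>

lemma int_adjoin_eq:
  assumes "poly (cubic a) r = 0"
  shows "int_adjoin r = range (ev r)"
proof -
  have r: "r ^ 3 = 1 + of_int a * r - (of_int a - 1) * r\<^sup>2"
    using assms by (simp add: cubic_eval)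
  have "poly (map_poly of_int p) r \<in> range (ev r)" for p :: "int poly"
  proof (induction p)
    case 0
    show ?case by (rule range_eqI[of _ _ 0]) (simp add: ev_zero)
  next
    case (pCons c p)
    then obtain t where "poly (map_poly of_int p) r = ev r t" by blast
    then have "poly (map_poly of_int (pCons c p)) r = ev r ((c, 0, 0) + mul a (0, 1, 0) t)"
      by (simp add: map_poly_pCons ev_add ev_mul[OF r])
    then show ?case by blast
  qed
  moreover have "ev r t \<in> int_adjoin r" for t
  proof -
    obtain x y z where t: "t = (x, y, z)" by (metis surj_pair)
    have "ev r t = poly (map_poly of_int [:x, y, z:]) r"
      by (simp add: t map_poly_pCons algebra_simps power2_eq_square)
    then show ?thesis unfolding int_adjoin_def by blast
  qed
  ultimately show ?thesis unfolding int_adjoin_def by auto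
qed

lemma field_embedding_ev:
  assumes \<sigma>: "field_embedding (rat_adjoin r) \<sigma>"
  shows "\<sigma> (ev r t) = ev (\<sigma> r) t"
proof -
  have K: "ev r t \<in> rat_adjoin r" for t
  proof -
    obtain x y z where t: "t = (x, y, z)" by (metis surj_pair)
    have "ev r t = rat_eval r [:of_int x, of_int y, of_int z:] / rat_eval r 1"
      by (simp add: t algebra_simps power2_eq_square)
    moreover have "rat_eval r 1 \<noteq> 0" by simp
    ultimately show ?thesis unfolding rat_adjoin_def rat_eval_def by blast
  qed
  have int: "of_int n \<in> rat_adjoin r" for n using K[of "(n, 0, 0)"] by simp
  have rK: "r \<in> rat_adjoin r" using K[of "(0, 1, 0)"] by simp
  have add: "\<sigma> (x + y) = \<sigma> x + \<sigma> y" and mult: "\<sigma> (x * y) = \<sigma> x * \<sigma> y"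
    if "x \<in> rat_adjoin r" "y \<in> rat_adjoin r" for x y
    using \<sigma> that unfolding field_embedding_def by blast+
  have one: "\<sigma> 1 = 1" using \<sigma> unfolding field_embedding_def by blast
  have zero: "\<sigma> 0 = 0" using add[OF int[of 0] int[of 0]] by simp
  have nat: "\<sigma> (of_nat n) = of_nat n" for n
  proof (induction n)
    case 0
    show ?case using zero by simp
  next
    case (Suc n)
    then show ?case using add[OF int[of 1] int[of "int n"]] one by simp
  qed
  have of_int: "\<sigma> (of_int n) = of_int n" for n
  proof (cases n rule: int_cases2)
    case (nonneg m)
    then show ?thesis using nat[of m] by simp
  next
    case (nonpos m)
    then show ?thesis using nat[of m] add[OF int[of "int m"] int[of "- int m"]] zero by simp
  qed
  obtain x y z where t: "t = (x, y, z)" by (metis surj_pair)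
  \<comment> \<open>Bracketed so that every intermediate term is one of the elements of the field
    listed next, where \<open>\<sigma>\<close> is known to be additive and multiplicative.\<close>
  have e: "ev r t = of_int x + (of_int y * r + of_int z * (r * r))"
    by (simp add: t power2_eq_square)
  have mem: "of_int y * r \<in> rat_adjoin r" "r * r \<in> rat_adjoin r" "of_int z * (r * r) \<in> rat_adjoin r"
    "of_int y * r + of_int z * (r * r) \<in> rat_adjoin r"
    using K[of "(0, y, 0)"] K[of "(0, 0, 1)"] K[of "(0, 0, z)"] K[of "(0, y, z)"]
    by (simp_all add: power2_eq_square)
  show ?thesis
    unfolding e by (simp add: add mult int rK mem of_int) (simp add: t power2_eq_square)
qed

theorem theorem1p1:
  fixes a :: int and \<rho> \<rho>' \<rho>'' :: real and \<sigma>\<^sub>1 \<sigma>\<^sub>2 \<sigma>\<^sub>3 :: "real \<Rightarrow> real"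
  assumes "a \<ge> 3"
    and "poly (cubic a) \<rho> = 0" and "\<rho> > 1"
    and "poly (cubic a) \<rho>' = 0" and "-1 < \<rho>'" and "\<rho>' < 0"
    and "poly (cubic a) \<rho>'' = 0" and "\<rho>'' < -1"
    and "field_embedding (rat_adjoin \<rho>) \<sigma>\<^sub>1" and "\<sigma>\<^sub>1 \<rho> = \<rho>"
    and "field_embedding (rat_adjoin \<rho>) \<sigma>\<^sub>2" and "\<sigma>\<^sub>2 \<rho> = \<rho>'"
    and "field_embedding (rat_adjoin \<rho>) \<sigma>\<^sub>3" and "\<sigma>\<^sub>3 \<rho> = \<rho>''"
  shows "(\<forall>\<alpha> \<in> listed_elements a \<rho>.
            signature \<sigma>\<^sub>1 \<sigma>\<^sub>2 \<sigma>\<^sub>3 \<alpha> \<in> signatures \<and>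
            indecomposable (signature \<sigma>\<^sub>1 \<sigma>\<^sub>2 \<sigma>\<^sub>3) (int_adjoin \<rho>) (signature \<sigma>\<^sub>1 \<sigma>\<^sub>2 \<sigma>\<^sub>3 \<alpha>) \<alpha>) \<and>
         (\<forall>s \<in> signatures. \<forall>\<alpha>.
            indecomposable (signature \<sigma>\<^sub>1 \<sigma>\<^sub>2 \<sigma>\<^sub>3) (int_adjoin \<rho>) s \<alpha> \<longrightarrow>
            (\<exists>\<beta> \<in> listed_elements a \<rho>. \<exists>u \<in> units_of_order (int_adjoin \<rho>). \<alpha> = \<beta> * u))"
proof -
  interpret three_roots a \<rho> \<rho>' \<rho>''
    by unfold_locales (use assms in auto)
  let ?sig = "signature \<sigma>\<^sub>1 \<sigma>\<^sub>2 \<sigma>\<^sub>3"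
  have O: "int_adjoin \<rho> = range (ev \<rho>)" by (rule int_adjoin_eq[OF assms(2)])
  have sig: "?sig (ev \<rho> t) = (sgn (ev \<rho> t), sgn (ev \<rho>' t), sgn (ev \<rho>'' t))" for t
    unfolding signature_def using assms by (simp add: field_embedding_ev del: ev.simps)
  have same: "?sig (ev \<rho> s) = ?sig (ev \<rho> t) \<longleftrightarrow> same_signs s t" for s t
    unfolding sig same_signs_def by simp
  have indec: "indecomposable ?sig (int_adjoin \<rho>) (?sig (ev \<rho> t)) (ev \<rho> t) \<longleftrightarrow> \<not> decomposable t"
    if t: "ev \<rho> t \<noteq> 0" for t
  proof -
    have part: "\<beta> \<in> signature_part ?sig (int_adjoin \<rho>) (?sig (ev \<rho> t)) \<longleftrightarrow>
        (\<exists>b. \<beta> = ev \<rho> b \<and> same_signs b t)" for \<beta>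
    proof -
      have "ev \<rho> b \<noteq> 0" if "same_signs b t" for b
        using that t unfolding same_signs_def by (metis sgn_eq_0_iff)
      then show ?thesis unfolding signature_part_def O
        by (auto simp: same simp del: ev.simps split_paired_Ex split_paired_All)
    qed
    have "same_signs t t" by (simp add: same_signs_def)
    moreover have "ev \<rho> t = ev \<rho> b + ev \<rho> c \<longleftrightarrow> t = b + c" for b c
      using ev_inject[of t "b + c"] by (auto simp: ev_add)
    ultimately show ?thesis unfolding indecomposable_def decomposable_def Bex_def part by blast
  qed
  have L: "listed_elements a \<rho> = ev \<rho> ` listed"
  proof -
    have "listed_elements a \<rho> = {ev \<rho> (1, 0, 0)}
      \<union> {ev \<rho> (1, s, 1) | s. 1 \<le> s \<and> s \<le> a - 1}
      \<union> {ev \<rho> (- v, - (a * (v - 1) + w), a * (v - 1) + w + 1) | v w.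
           1 \<le> v \<and> v \<le> a - 1 \<and> max 1 (v - 1) \<le> w \<and> w \<le> a - 1}
      \<union> {ev \<rho> (- 1, - u, u + 2) | u. 0 \<le> u \<and> u \<le> a - 2}"
    proof -
      have "ev \<rho> (1, 0, 0) = 1" "ev \<rho> (1, s, 1) = 1 + of_int s * \<rho> + \<rho>\<^sup>2"
        "ev \<rho> (- v, - (a * (v - 1) + w), a * (v - 1) + w + 1)
           = - of_int v - of_int (a * (v - 1) + w) * \<rho> + of_int (a * (v - 1) + w + 1) * \<rho>\<^sup>2"
        "ev \<rho> (- 1, - u, u + 2) = - 1 - of_int u * \<rho> + of_int (u + 2) * \<rho>\<^sup>2" for s u v w
        by (simp_all add: algebra_simps)
      then show ?thesis by (simp only: listed_elements_def)
    qed
    also have "\<dots> = ev \<rho> ` listed" unfolding listed_def by blast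
    finally show ?thesis .
  qed
  show ?thesis
  proof (intro conjI ballI allI impI)
    fix \<alpha> assume "\<alpha> \<in> listed_elements a \<rho>"
    then obtain t where t: "t \<in> listed" "\<alpha> = ev \<rho> t" unfolding L by blast
    note li = listed_indecomposable[OF t(1)]
    show "?sig \<alpha> \<in> signatures"
      using li unfolding t(2) sig signatures_def pos_def mix_def by (elim conjE disjE) simp_all
    show "indecomposable ?sig (int_adjoin \<rho>) (?sig \<alpha>) \<alpha>"
      using li indec[of t] unfolding t(2) pos_def mix_def by (metis less_irrefl)
  next
    fix s \<alpha> assume s: "s \<in> signatures" and i: "indecomposable ?sig (int_adjoin \<rho>) s \<alpha>"
    have "\<alpha> \<in> signature_part ?sig (int_adjoin \<rho>) s"
      using i unfolding indecomposable_def by (rule conjunct1)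
    then obtain t where t: "\<alpha> = ev \<rho> t" "\<alpha> \<noteq> 0" "?sig \<alpha> = s"
      unfolding signature_part_def O by blast
    have "ev \<rho> t \<noteq> 0" "ev \<rho>' t \<noteq> 0" "ev \<rho>'' t \<noteq> 0"
      using s t(3) unfolding t(1) sig signatures_def by (auto simp del: ev.simps)
    then have "classified t" by (rule nonzero_classified)
    moreover have "\<not> decomposable t" using i indec[of t] t by simp
    \<comment> \<open>The unit required in the conclusion is the inverse \<open>v\<close>, as
      \<open>u\<close> carries \<open>t\<close> to the listed element.\<close>
    ultimately obtain u v where u: "mul a u t \<in> listed" and v: "mul a u v = (1, 0, 0)"
      unfolding classified_def invertible_def by blast
    have uv: "ev \<rho> u * ev \<rho> v = 1" using ev_mul1[of u v] v by simp
    then have "ev \<rho> v * ev \<rho> u = 1" by (simp only: mult.commute)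
    then have "ev \<rho> v \<in> units_of_order (int_adjoin \<rho>)"
      unfolding units_of_order_def O by blast
    moreover have "\<alpha> = ev \<rho> (mul a u t) * ev \<rho> v"
      using uv unfolding t(1) ev_mul1 by (metis mult.assoc mult.commute mult_1)
    ultimately show "\<exists>\<beta> \<in> listed_elements a \<rho>. \<exists>u \<in> units_of_order (int_adjoin \<rho>). \<alpha> = \<beta> * u"
      unfolding L using u by blast
  qed
qed

end
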